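(* For all $v\in\{1,2,\dots,V\}$ we have $\tilde{\mathfrak{H}}_{V,v}=\tilde{\mathfrak{H}}_{V,1}$. Moreover, suppose that $\mathcal{P}^{a}=\dfrac{P_{n_1}P_{n_2}\cdots P_{n_V}}{V^{MV}}$ for every $a\in\mathcal{A}$. Let $\mu^{(1)}\in\mathbb{P}^V$ be any initial $V$-tuple of probability measures on $\mathbb{X}$, and let $\mu^{(l+1)}=f^{a^{(l)}}(\mu^{(l)})$ for $l\ge1$, where $a^{(1)},a^{(2)},\dots$ are chosen independently from $\mathcal{A}$ with probabilities $\{\mathcal{P}^a\}_{a\in\mathcal{A}}$. Then, almost surely, for every $v\in\{1,\dots,V\}$ the empirical measures $\frac1n\sum_{l=1}^n\delta_{\mu^{(l)}_v}$ on $\mathbb{P}$ of the $v$-th components converge weakly, as $n\to\infty$, to the marginal probability measure $$\tilde{\mathfrak{P}}_{V,1}(B):=\tilde{\mathfrak{P}}_V(B\times\mathbb{P}\times\cdots\times\mathbb{P}),\qquad B\subset\mathbb{P}\text{ Borel},$$ independently of $v$.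
   Context: IFS. An IFS (with probabilities) on a compact metric space $Y$ is a finite family of contraction maps $g_a:Y\to Y$ together with probabilities $p_a\ge 0$, $\sum_a p_a=1$. Its set attractor is the unique non-empty compact $A\subset Y$ with $A=\bigcup_a g_a(A)$; its measure attractor is the unique Borel probability measure $\mu$ on $Y$ with $\mu=\sum_a p_a\, g_a(\mu)$, where $g(\mu)=\mu\circ g^{-1}$. SuperIFS. $(\mathbb{X},d)$ is a compact metric space; $M,N,V$ are positive integers. For $n\in\{1,\dots,N\}$, $m\in\{1,\dots,M\}$, $f_m^n:\mathbb{X}\to\mathbb{X}$ is Lipschitz with constant $l$, where $0\le l<1$ is fixed, and $p_m^n\ge0$ with $\sum_{m=1}^Mp_m^n=1$ for each $n$. $P_1,\dots,P_N>0$ with $\sum_nP_n=1$. The IFS $\tilde{\mathcal{F}}_V$. $\mathbb{P}=\mathbb{P}(\mathbb{X})$ is the set of Borel probability measures on $\mathbb{X}$ with the Monge–Kantorovitch metric $d(\mu,\nu)=\sup\{\int f\,d\mu-\int f\,d\nu\}$ over $f:\mathbb{X}\to\mathbb{R}$ with Lipschitz constant at most $1$; $\mathbb{P}^V$ carries the maximum metric. For $f:\mathbb{X}\to\mathbb{X}$ and $\mu\in\mathbb{P}$, $f(\mu)=\mu\circ f^{-1}$. $\mathcal{A}=\{\{1,\dots,N\}\times\{1,\dots,V\}^M\}^V$; write $a=(a_1,\dots,a_V)\in\mathcal{A}$ with $a_v=(n_v;v_{v,1},\dots,v_{v,M})$. $\{\mathcal{P}^a\}_{a\in\mathcal{A}}$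 are probabilities ($\mathcal P^a\ge0$, $\sum_a\mathcal P^a=1$). For $a\in\mathcal{A}$ define $f^a:\mathbb{P}^V\to\mathbb{P}^V$ by letting the $v$-th component of $f^a(\mu_1,\dots,\mu_V)$ be $\sum_{m=1}^M p_m^{n_v}f_m^{n_v}(\mu_{v_{v,m}})$. $\tilde{\mathcal{F}}_V=\{\mathbb{P}^V;f^a,\mathcal{P}^a,a\in\mathcal{A}\}$ is an IFS of contractions with set attractor $\tilde{\mathfrak{H}}_V\subset\mathbb{P}^V$ and measure attractor $\tilde{\mathfrak{P}}_V$. $\tilde{\mathfrak{H}}_{V,v}\subset\mathbb{P}$ is the set of $v$-th components of elements of $\tilde{\mathfrak{H}}_V$. *)

theory Defs
  imports "HOL-Probability.Probability"
begin

definition mixture :: "'b measure \<Rightarrow> 'i set \<Rightarrow> ('i \<Rightarrow> real) \<Rightarrow> ('i \<Rightarrow> 'b measure) \<Rightarrow> 'b measure" where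
  "mixture S I p \<mu> = measure_of (space S) (sets S) (\<lambda>B. \<Sum>i\<in>I. ennreal (p i) * emeasure (\<mu> i) B)"

definition borel_of :: "'b topology \<Rightarrow> 'b measure" where
  "borel_of T = sigma (topspace T) {U. openin T U}"

definition weakly_converges :: "'b topology \<Rightarrow> (nat \<Rightarrow> 'b measure) \<Rightarrow> 'b measure \<Rightarrow> bool" where
  "weakly_converges T \<nu> \<mu> \<longleftrightarrow>
     (\<forall>h. continuous_map T euclideanreal h \<and> bounded (h ` topspace T) \<longrightarrow>
        (\<lambda>n. \<integral>x. h x \<partial>\<nu> n) \<longlonglongrightarrow> (\<integral>x. h x \<partial>\<mu>))"

definition set_attractor :: "'b set \<Rightarrow> ('b \<Rightarrow> 'b \<Rightarrow> real) \<Rightarrow> 'i set \<Rightarrow> ('i \<Rightarrow> 'b \<Rightarrow> 'b) \<Rightarrow> 'b set" where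
  "set_attractor Y d I g =
     (THE A. A \<noteq> {} \<and> compactin (Metric_space.mtopology Y d) A \<and> A = (\<Union>i\<in>I. g i ` A))"

definition measure_attractor ::
    "'b set \<Rightarrow> ('b \<Rightarrow> 'b \<Rightarrow> real) \<Rightarrow> 'i set \<Rightarrow> ('i \<Rightarrow> 'b \<Rightarrow> 'b) \<Rightarrow> ('i \<Rightarrow> real) \<Rightarrow> 'b measure" where
  "measure_attractor Y d I g p =
     (let S = borel_of (Metric_space.mtopology Y d) in
      THE \<mu>. prob_space \<mu> \<and> sets \<mu> = sets S \<and> \<mu> = mixture S I p (\<lambda>i. distr \<mu> S (g i)))"

definition borel_probs :: "'x::topological_space measure set" where
  "borel_probs = {\<mu>. prob_space \<mu> \<and> sets \<mu> = sets borel}"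

text \<open>The value 0 outside \<^const>\<open>borel_probs\<close> is needed because \<^locale>\<open>Metric_space\<close> asks for
  nonnegativity on the whole type.  On a compact space the supremum ranges over a nonempty bounded
  set.\<close>
definition mk_dist :: "'x::metric_space measure \<Rightarrow> 'x measure \<Rightarrow> real" where
  "mk_dist \<mu> \<nu> = (if \<mu> \<in> borel_probs \<and> \<nu> \<in> borel_probs
     then Sup {(\<integral>x. h x \<partial>\<mu>) - (\<integral>x. h x \<partial>\<nu>) |h :: 'x \<Rightarrow> real. 1-lipschitz_on UNIV h}
     else 0)"

definition prob_tuples :: "nat \<Rightarrow> (nat \<Rightarrow> 'x::topological_space measure) set" where
  "prob_tuples V = (\<Pi>\<^sub>E v\<in>{1..V}. borel_probs)"

definition mk_dist_max ::
    "nat \<Rightarrow> (nat \<Rightarrow> 'x::metric_space measure) \<Rightarrow> (nat \<Rightarrow> 'x measure) \<Rightarrow> real" where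
  "mk_dist_max V \<mu> \<nu> = Max ((\<lambda>v. mk_dist (\<mu> v) (\<nu> v)) ` {1..V})"

text \<open>An index \<open>a\<close> has components \<open>a v = (n\<^sub>v, w\<^sub>v)\<close> with \<open>w\<^sub>v m = v\<^bsub>v,m\<^esub>\<close>.\<close>
type_synonym sifs_index = "nat \<Rightarrow> nat \<times> (nat \<Rightarrow> nat)"

definition sifs_indices :: "nat \<Rightarrow> nat \<Rightarrow> nat \<Rightarrow> sifs_index set" where
  "sifs_indices M N V = (\<Pi>\<^sub>E v\<in>{1..V}. {1..N} \<times> (\<Pi>\<^sub>E m\<in>{1..M}. {1..V}))"

text \<open>Here \<open>f n m\<close> and \<open>p n m\<close> are the map and the weight with upper index \<open>n\<close> and lower
  index \<open>m\<close>.\<close>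
definition sifs_map ::
    "nat \<Rightarrow> nat \<Rightarrow> (nat \<Rightarrow> nat \<Rightarrow> 'x \<Rightarrow> 'x::topological_space) \<Rightarrow> (nat \<Rightarrow> nat \<Rightarrow> real) \<Rightarrow>
     sifs_index \<Rightarrow> (nat \<Rightarrow> 'x measure) \<Rightarrow> (nat \<Rightarrow> 'x measure)" where
  "sifs_map M V f p a \<mu> = (\<lambda>v\<in>{1..V}. let (n, w) = a v in
     mixture borel {1..M} (p n) (\<lambda>m. distr (\<mu> (w m)) borel (f n m)))"

definition sifs_set_attractor ::
    "nat \<Rightarrow> nat \<Rightarrow> nat \<Rightarrow> (nat \<Rightarrow> nat \<Rightarrow> 'x \<Rightarrow> 'x::metric_space) \<Rightarrow> (nat \<Rightarrow> nat \<Rightarrow> real) \<Rightarrow>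
     (nat \<Rightarrow> 'x measure) set" where
  "sifs_set_attractor M N V f p =
     set_attractor (prob_tuples V) (mk_dist_max V) (sifs_indices M N V) (sifs_map M V f p)"

definition sifs_measure_attractor ::
    "nat \<Rightarrow> nat \<Rightarrow> nat \<Rightarrow> (nat \<Rightarrow> nat \<Rightarrow> 'x \<Rightarrow> 'x::metric_space) \<Rightarrow> (nat \<Rightarrow> nat \<Rightarrow> real) \<Rightarrow>
     (sifs_index \<Rightarrow> real) \<Rightarrow> (nat \<Rightarrow> 'x measure) measure" where
  "sifs_measure_attractor M N V f p Q =
     measure_attractor (prob_tuples V) (mk_dist_max V) (sifs_indices M N V) (sifs_map M V f p) Q"

definition component_set :: "nat \<Rightarrow> (nat \<Rightarrow> 'b) set \<Rightarrow> 'b set" where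
  "component_set v H = (\<lambda>\<mu>. \<mu> v) ` H"

abbreviation mk_topology :: "'x::metric_space measure topology" where
  "mk_topology \<equiv> Metric_space.mtopology borel_probs mk_dist"

definition first_marginal :: "(nat \<Rightarrow> 'x::metric_space measure) measure \<Rightarrow> 'x measure measure" where
  "first_marginal R = distr R (borel_of mk_topology) (\<lambda>\<mu>. \<mu> 1)"

definition empirical_measure :: "'b topology \<Rightarrow> (nat \<Rightarrow> 'b) \<Rightarrow> nat \<Rightarrow> 'b measure" where
  "empirical_measure T y n =
     mixture (borel_of T) {1..n} (\<lambda>_. 1 / real n) (\<lambda>k. return (borel_of T) (y k))"

end

theory Submission
  imports Defs "HOL-Library.Discrete_Functions"
begin

text \<open>Both attractors have explicit descriptions through addresses.  An infinite sequence \<open>s\<close> of indices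
  determines a tuple of measures, namely the laws of the limit points of random compositions of the maps
  \<open>f n m\<close>; this avoids proving that the space of probability measures is complete.  The set of all such
  tuples is the set attractor, and the image of the Bernoulli measure on sequences is the measure
  attractor.  Uniqueness of both makes them invariant under exchanging two buffers, since this exchange
  permutes the maps of the IFS.

  For the random orbit, the frequencies of all finite words among the chosen indices converge almost surely
  to their probabilities, and there are only countably many words.  As the last \<open>j\<close> indices determine an
  orbit point up to a multiple of \<open>l ^ j\<close>, and a continuous function varies little near the compact
  attractor, the averages of every bounded continuous function then converge.\<close>

subsection \<open>Mixtures and Borel measures of abstract topologies\<close>

text \<open>Weak convergence involves uncountably many test functions, so the exceptional null set
  has to be fixed before any of them. A sample path therefore enters only through its word
  frequencies, and everything after that, in \<open>orbit_averages\<close>, is deterministic.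
  Occurrences of a word at nearby times overlap and are dependent; adding one newest letter at a
  time turns the error into bounded martingale differences, whose orthogonality suffices for a
  strong law. Addresses and orbits run in opposite directions: the newest map is outermost in an
  orbit point, so the latest letters, read backwards, are the first letters of an address.
  \<open>coded_ifs\<close> assumes a bound on distances instead of compactness of the whole space,
  so test functions are controlled only near the attractor. Uniqueness of the invariant measure is
  tested on Lipschitz functions, because composition with the maps multiplies their constant by
  \<open>l\<close>. The product form of the weights enters only as invariance under
  \<open>swap_index\<close>.\<close>

lemma space_mixture [simp]: "space (mixture S I p \<mu>) = space S"
  by (simp add: mixture_def space_measure_of_conv)

lemma sets_mixture [simp, measurable_cong]: "sets (mixture S I p \<mu>) = sets S"
  by (simp add: mixture_def)

text \<open>\<open>measure_of\<close> returns the prescribed set function only if it is countably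
  additive; this follows by exchanging the finite sum with the series of nonnegative terms.\<close>

lemma emeasure_mixture:
  assumes "finite I" "\<And>i. i \<in> I \<Longrightarrow> sets (\<mu> i) = sets S" "B \<in> sets S"
  shows "emeasure (mixture S I p \<mu>) B = (\<Sum>i\<in>I. ennreal (p i) * emeasure (\<mu> i) B)"
proof (rule emeasure_measure_of[OF mixture_def])
  show "sets S \<subseteq> Pow (space S)"
    by (rule sets.space_closed)
  show "positive (sets (mixture S I p \<mu>)) (\<lambda>B. \<Sum>i\<in>I. ennreal (p i) * emeasure (\<mu> i) B)"
    by (simp add: positive_def)
  show "countably_additive (sets (mixture S I p \<mu>)) (\<lambda>B. \<Sum>i\<in>I. ennreal (p i) * emeasure (\<mu> i) B)"
  proof (rule countably_additiveI)
    fix A :: "nat \<Rightarrow> _"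
    assume A: "range A \<subseteq> sets (mixture S I p \<mu>)" "disjoint_family A"
    have "(\<Sum>k. \<Sum>i\<in>I. ennreal (p i) * emeasure (\<mu> i) (A k))
        = (\<Sum>i\<in>I. \<Sum>k. ennreal (p i) * emeasure (\<mu> i) (A k))"
      by (rule suminf_sum) simp
    also have "\<dots> = (\<Sum>i\<in>I. ennreal (p i) * emeasure (\<mu> i) (\<Union>k. A k))"
      using A assms(2) by (intro sum.cong refl) (simp add: suminf_emeasure)
    finally show "(\<Sum>k. \<Sum>i\<in>I. ennreal (p i) * emeasure (\<mu> i) (A k))
        = (\<Sum>i\<in>I. ennreal (p i) * emeasure (\<mu> i) (\<Union>k. A k))" .
  qed
  show "B \<in> sets (mixture S I p \<mu>)"
    using assms by simp
qed

lemma mixture_eqI: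
  assumes "finite I" "\<And>i. i \<in> I \<Longrightarrow> sets (\<mu> i) = sets S" "sets N = sets S"
    and "\<And>B. B \<in> sets S \<Longrightarrow> emeasure N B = (\<Sum>i\<in>I. ennreal (p i) * emeasure (\<mu> i) B)"
  shows "N = mixture S I p \<mu>"
  by (rule measure_eqI) (use assms in \<open>simp_all add: emeasure_mixture\<close>)

lemma prob_space_mixture:
  assumes "finite I" "\<And>i. i \<in> I \<Longrightarrow> sets (\<mu> i) = sets S" "\<And>i. i \<in> I \<Longrightarrow> prob_space (\<mu> i)"
    and "\<And>i. i \<in> I \<Longrightarrow> 0 \<le> p i" "(\<Sum>i\<in>I. p i) = 1"
  shows "prob_space (mixture S I p \<mu>)"
proof (rule prob_spaceI)
  have "emeasure (\<mu> i) (space S) = 1" if "i \<in> I" for i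
    using assms(2,3)[OF that] prob_space.emeasure_space_1 sets_eq_imp_space_eq by metis
  then have "emeasure (mixture S I p \<mu>) (space S) = (\<Sum>i\<in>I. ennreal (p i))"
    using assms by (simp add: emeasure_mixture)
  also have "\<dots> = 1"
    using assms by (simp add: sum_ennreal)
  finally show "emeasure (mixture S I p \<mu>) (space (mixture S I p \<mu>)) = 1"
    by simp
qed

text \<open>Known on indicators by \<open>emeasure_mixture\<close>, the identity passes to
  nonnegative measurable functions by linearity and monotone limits.\<close>

lemma nn_integral_mixture:
  assumes I: "finite I" and \<mu>: "\<And>i. i \<in> I \<Longrightarrow> sets (\<mu> i) = sets S"
    and "h \<in> borel_measurable S"
  shows "integral\<^sup>N (mixture S I p \<mu>) h = (\<Sum>i\<in>I. ennreal (p i) * integral\<^sup>N (\<mu> i) h)"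
  using assms(3)
proof (induction rule: borel_measurable_induct)
  case (cong f g)
  have "integral\<^sup>N (\<mu> i) f = integral\<^sup>N (\<mu> i) g" if "i \<in> I" for i
    using cong sets_eq_imp_space_eq[OF \<mu>[OF that]] by (intro nn_integral_cong) simp
  moreover have "integral\<^sup>N (mixture S I p \<mu>) f = integral\<^sup>N (mixture S I p \<mu>) g"
    using cong by (intro nn_integral_cong) simp
  ultimately show ?case
    using cong by simp
next
  case (set A)
  then show ?case
    using I \<mu> by (simp add: emeasure_mixture)
next
  case (mult u c)
  have "u \<in> borel_measurable (\<mu> i)" if "i \<in> I" for i
    using mult(2) \<mu>[OF that] measurable_cong_sets by blast
  moreover have "u \<in> borel_measurable (mixture S I p \<mu>)"
    using mult(2) by simp
  ultimately show ?case
    using mult.IH by (simp add: nn_integral_cmult sum_distrib_left ac_simps)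
next
  case (add u v)
  have "u \<in> borel_measurable (\<mu> i)" "v \<in> borel_measurable (\<mu> i)" if "i \<in> I" for i
    using add(1,3) \<mu>[OF that] measurable_cong_sets by blast+
  moreover have "u \<in> borel_measurable (mixture S I p \<mu>)" "v \<in> borel_measurable (mixture S I p \<mu>)"
    using add by simp_all
  ultimately show ?case
    using add.IH by (simp add: nn_integral_add sum.distrib distrib_left)
next
  case (seq U)
  have U: "U k \<in> borel_measurable (\<mu> i)" if "i \<in> I" for i k
    using seq(1) \<mu>[OF that] measurable_cong_sets by blast
  have inc: "incseq (\<lambda>k. ennreal (p i) * integral\<^sup>N (\<mu> i) (U k))" for i
    using seq by (intro incseq_SucI mult_left_mono nn_integral_mono)
      (auto simp: incseq_Suc_iff le_fun_def)
  have eq: "(SUP k. U k) = (\<lambda>x. SUP k. U k x)"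
    by (simp add: fun_eq_iff image_image)
  have "integral\<^sup>N (mixture S I p \<mu>) (\<lambda>x. SUP k. U k x)
      = (SUP k. \<Sum>i\<in>I. ennreal (p i) * integral\<^sup>N (\<mu> i) (U k))"
    using seq by (subst nn_integral_monotone_convergence_SUP) simp_all
  also have "\<dots> = (\<Sum>i\<in>I. SUP k. ennreal (p i) * integral\<^sup>N (\<mu> i) (U k))"
    by (rule ennreal_SUP_sum) (rule inc)
  also have "\<dots> = (\<Sum>i\<in>I. ennreal (p i) * integral\<^sup>N (\<mu> i) (\<lambda>x. SUP k. U k x))"
    using seq U by (intro sum.cong refl)
      (simp add: SUP_mult_left_ennreal nn_integral_monotone_convergence_SUP)
  finally show ?case
    unfolding eq .
qed

text \<open>Positive and negative parts are treated separately; both have finite integrals under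
  every component, so the passage from \<open>ennreal\<close> to reals commutes with the weighted
  sum.\<close>

lemma integral_mixture:
  fixes h :: "'a \<Rightarrow> real"
  assumes I: "finite I" and \<mu>: "\<And>i. i \<in> I \<Longrightarrow> sets (\<mu> i) = sets S"
    and p: "\<And>i. i \<in> I \<Longrightarrow> 0 \<le> p i"
    and h: "h \<in> borel_measurable S" and int: "\<And>i. i \<in> I \<Longrightarrow> integrable (\<mu> i) h"
  shows "integral\<^sup>L (mixture S I p \<mu>) h = (\<Sum>i\<in>I. p i * integral\<^sup>L (\<mu> i) h)"
proof -
  have fin: "(\<integral>\<^sup>+x. ennreal (g x) \<partial>\<mu> i) < \<top>" if "i \<in> I" "g = h \<or> g = (\<lambda>x. - h x)" for i g
    using int[OF that(1)] that(2) by (auto simp: real_integrable_def less_top)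
  have nn: "(\<integral>\<^sup>+x. ennreal (g x) \<partial>mixture S I p \<mu>)
      = ennreal (\<Sum>i\<in>I. p i * enn2real (\<integral>\<^sup>+x. ennreal (g x) \<partial>\<mu> i))"
    if g: "g = h \<or> g = (\<lambda>x. - h x)" for g
  proof -
    have "(\<integral>\<^sup>+x. ennreal (g x) \<partial>mixture S I p \<mu>)
        = (\<Sum>i\<in>I. ennreal (p i) * (\<integral>\<^sup>+x. ennreal (g x) \<partial>\<mu> i))"
      using g h by (intro nn_integral_mixture I \<mu>) auto
    also have "\<dots> = (\<Sum>i\<in>I. ennreal (p i * enn2real (\<integral>\<^sup>+x. ennreal (g x) \<partial>\<mu> i)))"
      using fin[OF _ g] p by (intro sum.cong refl) (simp add: ennreal_mult less_top)
    also have "\<dots> = ennreal (\<Sum>i\<in>I. p i * enn2real (\<integral>\<^sup>+x. ennreal (g x) \<partial>\<mu> i))"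
      using p by (simp add: sum_ennreal)
    finally show ?thesis .
  qed
  have "integrable (mixture S I p \<mu>) h"
    using h nn[of h] nn[of "\<lambda>x. - h x"] by (simp add: real_integrable_def)
  then have "integral\<^sup>L (mixture S I p \<mu>) h
      = enn2real (\<integral>\<^sup>+x. ennreal (h x) \<partial>mixture S I p \<mu>)
        - enn2real (\<integral>\<^sup>+x. ennreal (- h x) \<partial>mixture S I p \<mu>)"
    by (rule real_lebesgue_integral_def)
  also have "\<dots> = (\<Sum>i\<in>I. p i * enn2real (\<integral>\<^sup>+x. ennreal (h x) \<partial>\<mu> i))
      - (\<Sum>i\<in>I. p i * enn2real (\<integral>\<^sup>+x. ennreal (- h x) \<partial>\<mu> i))"
    using p nn[of h] nn[of "\<lambda>x. - h x"] by (simp add: sum_nonneg)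
  also have "\<dots> = (\<Sum>i\<in>I. p i * integral\<^sup>L (\<mu> i) h)"
    using int by (simp add: real_lebesgue_integral_def sum_subtractf right_diff_distrib)
  finally show ?thesis .
qed

lemma space_borel_of [simp]: "space (borel_of T) = topspace T"
  by (simp add: borel_of_def space_measure_of_conv)

lemma sets_borel_of: "sets (borel_of T) = sigma_sets (topspace T) {U. openin T U}"
  unfolding borel_of_def by (rule sets_measure_of) (use openin_subset in blast)

lemma openin_sets_borel_of: "openin T U \<Longrightarrow> U \<in> sets (borel_of T)"
  by (auto simp: sets_borel_of)

lemma closedin_sets_borel_of:
  assumes "closedin T C"
  shows "C \<in> sets (borel_of T)"
proof -
  have "space (borel_of T) - (topspace T - C) \<in> sets (borel_of T)"
    using assms by (intro sets.compl_sets openin_sets_borel_of) auto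
  then show ?thesis
    using closedin_subset[OF assms] by (simp add: double_diff)
qed

text \<open>Closed sets are the convenient generator because their indicators are decreasing limits
  of Lipschitz functions, as used in \<open>measure_eqI_lipschitz\<close>.\<close>

lemma sets_borel_of_closed: "sets (borel_of T) = sigma_sets (topspace T) {C. closedin T C}"
proof
  show "sigma_sets (topspace T) {C. closedin T C} \<subseteq> sets (borel_of T)"
    using sets.sigma_sets_subset[of "{C. closedin T C}" "borel_of T"] closedin_sets_borel_of by auto
  interpret sigma_algebra "topspace T" "sigma_sets (topspace T) {C. closedin T C}"
    by (rule sigma_algebra_sigma_sets) (use closedin_subset in blast)
  have "U \<in> sigma_sets (topspace T) {C. closedin T C}" if "openin T U" for U
  proof -
    have "topspace T - (topspace T - U) \<in> sigma_sets (topspace T) {C. closedin T C}"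
      using that by (intro sigma_sets.Compl sigma_sets.Basic) auto
    then show ?thesis
      using openin_subset[OF that] by (simp add: double_diff)
  qed
  then show "sets (borel_of T) \<subseteq> sigma_sets (topspace T) {C. closedin T C}"
    unfolding sets_borel_of by (intro sigma_sets_subset) auto
qed

lemma borel_of_euclidean: "borel_of euclidean = borel"
  by (simp add: borel_of_def borel_def)

lemma measurable_borel_ofI:
  assumes "\<And>x. x \<in> space N \<Longrightarrow> h x \<in> topspace T"
    and "\<And>U. openin T U \<Longrightarrow> {x \<in> space N. h x \<in> U} \<in> sets N"
  shows "h \<in> measurable N (borel_of T)"
  unfolding borel_of_def
  by (rule measurable_measure_of) (use assms in \<open>auto dest: openin_subset simp: vimage_def Int_def conj_commute\<close>)

lemma continuous_map_measurable_borel_of: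
  assumes "continuous_map T T' h"
  shows "h \<in> measurable (borel_of T) (borel_of T')"
proof (rule measurable_borel_ofI)
  show "h x \<in> topspace T'" if "x \<in> space (borel_of T)" for x
    using assms that by (auto simp: continuous_map_def)
  show "{x \<in> space (borel_of T). h x \<in> U} \<in> sets (borel_of T)" if "openin T' U" for U
    using openin_continuous_map_preimage[OF assms that] openin_sets_borel_of by auto
qed

lemma continuous_map_borel_measurable:
  "continuous_map T euclideanreal h \<Longrightarrow> h \<in> borel_measurable (borel_of T)"
  using continuous_map_measurable_borel_of[of T euclideanreal h] by (simp add: borel_of_euclidean)

section \<open>Lipschitz test functions determine a Borel probability measure\<close>

context Metric_space
begin

text \<open>The counterpart of \<open>lipschitz_on\<close> for a metric given by an explicit carrier
  and distance, as is the case for tuples of measures.\<close>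

definition lipschitz_fun :: "real \<Rightarrow> ('a \<Rightarrow> real) \<Rightarrow> bool" where
  "lipschitz_fun L h \<longleftrightarrow> 0 \<le> L \<and> (\<forall>x\<in>M. \<forall>y\<in>M. \<bar>h x - h y\<bar> \<le> L * d x y)"

lemma lipschitz_fun_continuous:
  assumes "lipschitz_fun L h"
  shows "continuous_map mtopology euclideanreal h"
  unfolding mtopology_is_euclidean[symmetric]
proof (subst metric_continuous_map, unfold_locales, intro conjI ballI allI impI)
  fix a and \<epsilon> :: real
  assume a: "a \<in> M" and \<epsilon>: "0 < \<epsilon>"
  have L: "0 \<le> L" "\<And>x. x \<in> M \<Longrightarrow> \<bar>h a - h x\<bar> \<le> L * d a x"
    using assms a by (auto simp: lipschitz_fun_def)
  \<comment> \<open>Dividing by \<open>L + 1\<close> instead of \<open>L\<close> covers the case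
    \<open>L = 0\<close>.\<close>
  have "dist (h a) (h x) < \<epsilon>" if "x \<in> M" "d a x < \<epsilon> / (L + 1)" for x
  proof -
    have "(L + 1) * d a x < \<epsilon>"
      using that(2) L(1) by (simp add: field_simps)
    then show ?thesis
      using L(2)[OF that(1)] nonneg[of a x] unfolding dist_real_def distrib_right by linarith
  qed
  then show "\<exists>\<delta>>0. \<forall>x. x \<in> M \<and> d a x < \<delta> \<longrightarrow> dist (h a) (h x) < \<epsilon>"
    using \<epsilon> L(1) by (intro exI[of _ "\<epsilon> / (L + 1)"]) auto
qed auto

lemma lipschitz_fun_infdist:
  assumes "C \<subseteq> M" "C \<noteq> {}"
  shows "lipschitz_fun 1 (\<lambda>x. INF c\<in>C. d x c)"
proof -
  have bdd: "bdd_below ((\<lambda>c. d x c) ` C)" for x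
    by (rule bdd_belowI2[of _ 0]) simp
  have "(INF c\<in>C. d x c) \<le> (INF c\<in>C. d y c) + d x y" if xy: "x \<in> M" "y \<in> M" for x y
  proof -
    have "(INF c\<in>C. d x c) - d x y \<le> d y c" if "c \<in> C" for c
    proof -
      have "(INF c\<in>C. d x c) \<le> d x c"
        by (rule cINF_lower[OF bdd that])
      also have "\<dots> \<le> d x y + d y c"
        using xy that assms by (intro triangle) auto
      finally show ?thesis
        by simp
    qed
    then have "(INF c\<in>C. d x c) - d x y \<le> (INF c\<in>C. d y c)"
      using assms by (intro cINF_greatest)
    then show ?thesis
      by simp
  qed
  note * = this
  have "\<bar>(INF c\<in>C. d x c) - (INF c\<in>C. d y c)\<bar> \<le> d x y" if "x \<in> M" "y \<in> M" for x y
    using *[of x y] *[of y x] that commute[of x y] by linarith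
  then show ?thesis
    by (simp add: lipschitz_fun_def)
qed

text \<open>With \<open>D\<close> the distance to a closed set \<open>C\<close>, the functions
  \<open>max 0 (1 - n * D x)\<close> are Lipschitz and converge pointwise to the indicator of
  \<open>C\<close>. Dominated convergence yields agreement on closed sets, which are stable under
  intersection and generate.\<close>

lemma measure_eqI_lipschitz:
  assumes "prob_space \<mu>" "prob_space \<nu>"
    and \<mu>: "sets \<mu> = sets (borel_of mtopology)" and \<nu>: "sets \<nu> = sets (borel_of mtopology)"
    and eq: "\<And>L h. lipschitz_fun L h \<Longrightarrow> (\<And>x. 0 \<le> h x \<and> h x \<le> 1) \<Longrightarrow> integral\<^sup>L \<mu> h = integral\<^sup>L \<nu> h"
  shows "\<mu> = \<nu>"
proof (rule measure_eqI_generator_eq[where E = "{C. closedin mtopology C}" and \<Omega> = M and A = "\<lambda>_. M"])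
  interpret \<mu>: prob_space \<mu> by fact
  interpret \<nu>: prob_space \<nu> by fact
  show "Int_stable {C. closedin mtopology C}"
    by (auto simp: Int_stable_def)
  show "{C. closedin mtopology C} \<subseteq> Pow M"
    by (simp add: Collect_mono_iff closedin_metric subset_iff Pow_def)
  show "sets \<mu> = sigma_sets M {C. closedin mtopology C}" "sets \<nu> = sigma_sets M {C. closedin mtopology C}"
    using \<mu> \<nu> by (simp_all add: sets_borel_of_closed)
  show "emeasure \<mu> C = emeasure \<nu> C" if "C \<in> {C. closedin mtopology C}" for C
  proof (cases "C = {}")
    case False
    have C: "closedin mtopology C" "C \<subseteq> M"
      using that closedin_metric by auto
    define D where "D x = (INF c\<in>C. d x c)" for x
    define h where "h n x = max 0 (1 - real n * D x)" for n x
    have D0: "0 \<le> D x" for x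
      unfolding D_def using False by (intro cINF_greatest) auto
    have lip: "lipschitz_fun (real n) (h n)" for n
    proof -
      have "\<bar>h n x - h n y\<bar> \<le> real n * \<bar>D x - D y\<bar>" for x y
      proof -
        have "\<bar>h n x - h n y\<bar> \<le> \<bar>real n * D x - real n * D y\<bar>"
          unfolding h_def by linarith
        also have "\<dots> = real n * \<bar>D x - D y\<bar>"
          by (simp add: abs_mult flip: right_diff_distrib)
        finally show ?thesis .
      qed
      moreover have "\<bar>D x - D y\<bar> \<le> d x y" if "x \<in> M" "y \<in> M" for x y
        using lipschitz_fun_infdist[OF C(2) False] that by (auto simp: lipschitz_fun_def D_def)
      ultimately show ?thesis
        unfolding lipschitz_fun_def by (meson of_nat_0_le_iff mult_left_mono order_trans)
    qed
    have h01: "0 \<le> h n x \<and> h n x \<le> 1" for n x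
      using D0[of x] by (simp add: h_def)
    have lim: "(\<lambda>n. h n x) \<longlonglongrightarrow> indicator C x" if "x \<in> M" for x
    proof (cases "x \<in> C")
      case True
      have "D x \<le> d x x"
        unfolding D_def using True by (intro cINF_lower bdd_belowI2[of _ 0]) auto
      then have "D x = 0"
        using D0[of x] that by simp
      then show ?thesis
        using True by (simp add: h_def)
    next
      case nC: False
      \<comment> \<open>A point off the closed set has positive distance from it, so
        \<open>h n x\<close> vanishes as soon as \<open>n\<close> reaches
        \<open>1 / D x\<close>.\<close>
      obtain r where r: "r > 0" "disjnt C (mball x r)"
      proof -
        have "x \<in> M - C"
          using \<open>x \<in> M\<close> nC by simp
        then have "\<exists>r>0. disjnt C (mball x r)"
          using C(1) closedin_metric by simp
        then show thesis
          using that by auto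
      qed
      have "r \<le> d x c" if "c \<in> C" for c
        using r(2) that C(2) \<open>x \<in> M\<close> by (meson disjnt_iff in_mball linorder_not_less subsetD)
      then have "r \<le> D x"
        unfolding D_def using False by (intro cINF_greatest)
      then have Dx: "0 < D x"
        using r by simp
      have "\<forall>\<^sub>F n in sequentially. 1 / D x \<le> real n"
        using filterlim_real_sequentially by (simp add: filterlim_at_top)
      then have "\<forall>\<^sub>F n in sequentially. h n x = 0"
        by eventually_elim (use Dx in \<open>simp add: h_def field_simps\<close>)
      then show ?thesis
        using nC by (simp add: tendsto_eventually)
    qed
    have conv: "(\<lambda>n. integral\<^sup>L \<rho> (h n)) \<longlonglongrightarrow> measure \<rho> C"
      if "prob_space \<rho>" "sets \<rho> = sets (borel_of mtopology)" for \<rho>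
    proof -
      interpret \<rho>: prob_space \<rho> by fact
      have sp: "space \<rho> = M"
        using sets_eq_imp_space_eq[OF that(2)] by simp
      have Cs: "C \<in> sets \<rho>"
        using closedin_sets_borel_of[OF C(1)] that(2) by simp
      have "(\<lambda>n. integral\<^sup>L \<rho> (h n)) \<longlonglongrightarrow> (\<integral>x. indicator C x \<partial>\<rho>)"
      proof (rule integral_dominated_convergence[where w = "\<lambda>_. 1"])
        show "h n \<in> borel_measurable \<rho>" for n
          using continuous_map_borel_measurable[OF lipschitz_fun_continuous[OF lip]] that(2)
          by (metis measurable_cong_sets)
      qed (use Cs lim sp h01 in auto)
      then show ?thesis
        using Cs sets.sets_into_space[OF Cs] by (simp add: Int_absorb2)
    qed
    have "measure \<mu> C = measure \<nu> C"
      using LIMSEQ_unique[OF conv[OF assms(1) \<mu>]] conv[OF assms(2) \<nu>] eq[OF lip h01] by simp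
    then show ?thesis
      by (simp add: \<mu>.emeasure_eq_measure \<nu>.emeasure_eq_measure)
  qed simp
  have "space \<mu> = M" "space \<nu> = M"
    using sets_eq_imp_space_eq[OF \<mu>] sets_eq_imp_space_eq[OF \<nu>] by simp_all
  show "range (\<lambda>_::nat. M) \<subseteq> {C. closedin mtopology C}" "(\<Union>_::nat. M) = M"
    by auto
  show "emeasure \<mu> M \<noteq> \<infinity>"
    by simp
qed

end

subsection \<open>Iterated function systems with a coding map\<close>

text \<open>The map \<open>code\<close> stands in for the limits of compositions that completeness
  would supply. Only its functional equation is assumed; its continuity and measurability follow
  from the contraction factor \<open>l\<close> and the bound \<open>D\<close> on distances.\<close>

locale coded_ifs = Metric_space Y d
  for Y :: "'b set" and d :: "'b \<Rightarrow> 'b \<Rightarrow> real" +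
  fixes I :: "'i set" and g :: "'i \<Rightarrow> 'b \<Rightarrow> 'b" and Q :: "'i \<Rightarrow> real"
    and l D :: real and code :: "'i stream \<Rightarrow> 'b"
  assumes finite_I: "finite I"
    and g_in: "\<And>i y. i \<in> I \<Longrightarrow> y \<in> Y \<Longrightarrow> g i y \<in> Y"
    and g_contraction: "\<And>i y z. i \<in> I \<Longrightarrow> y \<in> Y \<Longrightarrow> z \<in> Y \<Longrightarrow> d (g i y) (g i z) \<le> l * d y z"
    and l: "0 \<le> l" "l < 1"
    and diameter: "\<And>y z. y \<in> Y \<Longrightarrow> z \<in> Y \<Longrightarrow> d y z \<le> D"
    and Q_nonneg: "\<And>i. i \<in> I \<Longrightarrow> 0 \<le> Q i"
    and Q_sum: "(\<Sum>i\<in>I. Q i) = 1"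
    and code_in: "\<And>s. s \<in> streams I \<Longrightarrow> code s \<in> Y"
    and code_Stream: "\<And>i s. i \<in> I \<Longrightarrow> s \<in> streams I \<Longrightarrow> code (i ## s) = g i (code s)"
begin

lemma I_nonempty: "I \<noteq> {}"
  using Q_sum by auto

text \<open>A fixed tail that extends finite words to addresses and also supplies a point of
  \<open>Y\<close>.\<close>

definition some_code :: "'i stream" where
  "some_code = (SOME s. s \<in> streams I)"

lemma some_code: "some_code \<in> streams I"
proof -
  obtain i where "i \<in> I"
    using I_nonempty by blast
  then have "sconst i \<in> streams I"
    by (simp add: streams_iff_sset)
  then show ?thesis
    unfolding some_code_def by (rule someI)
qed

lemma power_l_D_small:
  assumes "0 < \<epsilon>"
  obtains k where "l ^ k * D < \<epsilon>"
proof -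
  have "(\<lambda>k. l ^ k * D) \<longlonglongrightarrow> 0 * D"
    using l by (intro tendsto_intros LIMSEQ_power_zero) simp
  then have "\<forall>\<^sub>F k in sequentially. l ^ k * D < \<epsilon>"
    using assms by (intro order_tendstoD(2)) auto
  then show thesis
    using that by (auto simp: eventually_sequentially)
qed

lemma foldr_g_in: "set w \<subseteq> I \<Longrightarrow> y \<in> Y \<Longrightarrow> foldr g w y \<in> Y"
  by (induction w) (auto intro: g_in)

text \<open>\<open>foldr\<close> applies the last letter of the word first, so the starting point
  sits under all \<open>length w\<close> contractions.\<close>

lemma foldr_g_contraction:
  assumes "set w \<subseteq> I" "y \<in> Y" "z \<in> Y"
  shows "d (foldr g w y) (foldr g w z) \<le> l ^ length w * D"
  using assms(1)
proof (induction w)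
  case Nil
  then show ?case
    using assms diameter by simp
next
  case (Cons i w)
  have "d (foldr g (i # w) y) (foldr g (i # w) z) \<le> l * d (foldr g w y) (foldr g w z)"
    using Cons.prems assms by (auto intro!: g_contraction foldr_g_in)
  also have "\<dots> \<le> l * (l ^ length w * D)"
    using Cons l by (intro mult_left_mono) auto
  finally show ?case
    by simp
qed

lemma code_shift: "set w \<subseteq> I \<Longrightarrow> s \<in> streams I \<Longrightarrow> code (w @- s) = foldr g w (code s)"
proof (induction w)
  case (Cons i w)
  then have "w @- s \<in> streams I"
    by (auto intro: shift_streams)
  then show ?case
    using Cons by (simp add: code_Stream)
qed simp

lemma stake_in: "s \<in> streams I \<Longrightarrow> set (stake k s) \<subseteq> I"
  by (induction k arbitrary: s) (auto dest: streams_shd streams_stl)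

lemma sdrop_in: "s \<in> streams I \<Longrightarrow> sdrop k s \<in> streams I"
  by (induction k arbitrary: s) (auto dest: streams_stl)

lemma foldr_near_code:
  assumes "s \<in> streams I" "y \<in> Y"
  shows "d (foldr g (stake k s) y) (code s) \<le> l ^ k * D"
proof -
  have "code s = foldr g (stake k s) (code (sdrop k s))"
    using code_shift[OF stake_in[OF assms(1)] sdrop_in[OF assms(1)], of k k]
    by (simp add: stake_sdrop)
  then show ?thesis
    using foldr_g_contraction[OF stake_in[OF assms(1), of k] assms(2) code_in[OF sdrop_in[OF assms(1), of k]]]
    by simp
qed

text \<open>This is the uniform continuity of \<open>code\<close> on sequences: a common prefix of
  length \<open>k\<close> means a common outer composition of \<open>k\<close> contractions.\<close>

lemma code_near_code:
  assumes "s \<in> streams I" "t \<in> streams I" "stake k s = stake k t"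
  shows "d (code s) (code t) \<le> l ^ k * D"
proof -
  have "code s = foldr g (stake k t) (code (sdrop k s))"
    using code_shift[OF stake_in[OF assms(1)] sdrop_in[OF assms(1)], of k k] assms(3)
    by (metis stake_sdrop)
  then show ?thesis
    using foldr_near_code[OF assms(2) code_in[OF sdrop_in[OF assms(1), of k]], of k] by simp
qed

section \<open>The set of coded points as the set attractor\<close>

definition attractor :: "'b set" where
  "attractor = code ` streams I"

lemma attractor_subset: "attractor \<subseteq> Y"
  using code_in by (auto simp: attractor_def)

text \<open>The sequences over a finite alphabet form a compact product of discrete spaces, and
  \<open>code\<close> is continuous on it. The neighbourhood of \<open>x\<close> used below is the
  cylinder fixing the first \<open>k\<close> letters.\<close>

lemma compactin_attractor: "compactin mtopology attractor"
proof -
  let ?T = "product_topology (\<lambda>_::nat. discrete_topology I) UNIV"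
  have top: "topspace ?T = {x. \<forall>n. x n \<in> I}"
    unfolding topspace_product_topology o_def topspace_discrete_topology PiE_UNIV_domain Pi_def by simp
  have to_in: "to_stream x \<in> streams I" if "x \<in> topspace ?T" for x
    using that unfolding top by (simp add: to_stream_in_streams)
  have "continuous_map ?T mtopology (code \<circ> to_stream)"
    unfolding continuous_map_to_metric
  proof (intro ballI allI impI)
    fix x and \<epsilon> :: real
    assume x: "x \<in> topspace ?T" and "0 < \<epsilon>"
    obtain k where k: "l ^ k * D < \<epsilon>"
      using power_l_D_small[OF \<open>0 < \<epsilon>\<close>] .
    let ?U = "Pi\<^sub>E UNIV (\<lambda>i. if i < k then {x i} else I)"
    have x': "x i \<in> I" for i
      using x unfolding top by simp
    have "openin ?T ?U"
    proof (subst openin_PiE_gen, intro disjI2 conjI ballI)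
      show "finite {i \<in> UNIV. (if i < k then {x i} else I) \<noteq> topspace (discrete_topology I)}"
        by (rule finite_subset[of _ "{..<k}"]) auto
      show "openin (discrete_topology I) (if i < k then {x i} else I)" for i
        using x' by simp
    qed
    moreover have "x \<in> ?U"
      using x' by (auto simp: PiE_def)
    moreover have "(code \<circ> to_stream) y \<in> mball ((code \<circ> to_stream) x) \<epsilon>" if y: "y \<in> ?U" for y
    proof -
      have yi: "y i \<in> (if i < k then {x i} else I)" for i
        using y by (auto simp: PiE_iff)
      have yI: "y i \<in> I" for i
        using yi[of i] x'[of i] by (auto split: if_splits)
      then have y': "y \<in> topspace ?T"
        unfolding top by simp
      have "stake k (to_stream x) = stake k (to_stream y)"
      proof (rule nth_equalityI)
        fix i assume "i < length (stake k (to_stream x))"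
        then show "stake k (to_stream x) ! i = stake k (to_stream y) ! i"
          using yi[of i] by (simp add: to_stream_def)
      qed simp
      then show ?thesis
        using code_near_code[OF to_in[OF x] to_in[OF y'], of k] k
          code_in[OF to_in[OF x]] code_in[OF to_in[OF y']] by simp
    qed
    ultimately show "\<exists>U. openin ?T U \<and> x \<in> U \<and> (\<forall>y\<in>U. (code \<circ> to_stream) y \<in> mball ((code \<circ> to_stream) x) \<epsilon>)"
      by blast
  qed
  moreover have "compactin ?T (topspace ?T)"
    using compact_space_product_topology[of "\<lambda>_::nat. discrete_topology I" UNIV] finite_I
    unfolding compact_space_def[symmetric] by (simp add: compact_space_discrete_topology)
  ultimately have "compactin mtopology ((code \<circ> to_stream) ` topspace ?T)"
    using image_compactin by blast
  moreover have "(code \<circ> to_stream) ` topspace ?T = attractor"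
  proof -
    have "s \<in> to_stream ` topspace ?T" if "s \<in> streams I" for s
    proof (rule image_eqI[of _ _ "\<lambda>n. s !! n"])
      show "s = to_stream (\<lambda>n. s !! n)"
        by (simp add: to_stream_def stream_smap_nats)
      show "(\<lambda>n. s !! n) \<in> topspace ?T"
        using that unfolding top by (auto intro: snth_in)
    qed
    then have "to_stream ` topspace ?T = streams I"
      using to_in by blast
    then show ?thesis
      by (metis attractor_def image_comp)
  qed
  ultimately show ?thesis
    by simp
qed

lemma attractor_invariant: "attractor = (\<Union>i\<in>I. g i ` attractor)"
proof
  show "attractor \<subseteq> (\<Union>i\<in>I. g i ` attractor)"
  proof
    fix y assume "y \<in> attractor"
    then obtain s where s: "s \<in> streams I" "y = code s"
      by (auto simp: attractor_def)
    then have "y = g (shd s) (code (stl s))"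
      using code_Stream[of "shd s" "stl s"] by (simp add: streams_shd streams_stl)
    then show "y \<in> (\<Union>i\<in>I. g i ` attractor)"
      using s by (auto simp: attractor_def intro: streams_shd streams_stl)
  qed
  show "(\<Union>i\<in>I. g i ` attractor) \<subseteq> attractor"
    unfolding attractor_def using code_Stream by (force simp: streams_Stream)
qed

text \<open>Choosing preimages inside \<open>A\<close> again and again gives each point of
  \<open>A\<close> an address, which forces it to be the coded point. Conversely, applying longer
  and longer prefixes of an address to one point of \<open>A\<close> stays in \<open>A\<close> and
  converges to the coded point, and \<open>A\<close> is closed.\<close>

lemma attractor_unique:
  assumes "A \<noteq> {}" "compactin mtopology A" and A: "A = (\<Union>i\<in>I. g i ` A)"
  shows "A = attractor"
proof
  have AY: "A \<subseteq> Y"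
    using compactin_subset_topspace[OF assms(2)] by simp
  have "\<exists>i z. i \<in> I \<and> z \<in> A \<and> y = g i z" if "y \<in> A" for y
    using A that by blast
  then obtain fi fz where fi: "\<And>y. y \<in> A \<Longrightarrow> fi y \<in> I" and fz: "\<And>y. y \<in> A \<Longrightarrow> fz y \<in> A"
    and eq: "\<And>y. y \<in> A \<Longrightarrow> y = g (fi y) (fz y)"
    by metis
  show "A \<subseteq> attractor"
  proof
    fix y assume y: "y \<in> A"
    \<comment> \<open>The itinerary of \<open>y\<close>: \<open>fz\<close> picks a preimage in
      \<open>A\<close>, and \<open>fi\<close> the letter of the map leading back from it.\<close>
    let ?s = "smap fi (siterate fz y)"
    have it: "(fz ^^ k) y \<in> A" for k
      by (induction k) (auto simp: y fz)
    have s: "?s \<in> streams I"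
      by (simp add: streams_iff_snth fi it)
    \<comment> \<open>The induction generalises over \<open>y\<close>, as dropping the first letter
      of its itinerary leaves the itinerary of \<open>fz y\<close>.\<close>
    have "y = foldr g (stake k ?s) ((fz ^^ k) y)" for k
      using y
    proof (induction k arbitrary: y)
      case (Suc k)
      have *: "stake (Suc k) (smap fi (siterate fz y)) = fi y # stake k (smap fi (siterate fz (fz y)))"
          "(fz ^^ Suc k) y = (fz ^^ k) (fz y)"
        by (simp_all only: stake.simps stream.map_sel siterate.simps funpow_Suc_right o_apply)
      show ?case
        unfolding * foldr.simps o_apply using eq[OF Suc.prems] Suc.IH[OF fz[OF Suc.prems]] by metis
    qed simp
    then have near: "d y (code ?s) \<le> l ^ k * D" for k
      using foldr_near_code[OF s, of "(fz ^^ k) y" k] it[of k] AY by (metis subsetD)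
    have "d y (code ?s) \<le> 0"
    proof (rule ccontr)
      assume "\<not> d y (code ?s) \<le> 0"
      then obtain k where "l ^ k * D < d y (code ?s)"
        using power_l_D_small[of "d y (code ?s)"] by (meson not_le)
      then show False
        using near[of k] by simp
    qed
    then have "y = code ?s"
      by (metis AY code_in[OF s] nonneg order_antisym subsetD y zero)
    then show "y \<in> attractor"
      unfolding attractor_def using s by blast
  qed
  show "attractor \<subseteq> A"
  proof
    fix y assume "y \<in> attractor"
    then obtain s where s: "s \<in> streams I" "y = code s"
      by (auto simp: attractor_def)
    obtain a where a: "a \<in> A"
      using assms(1) by blast
    have inA: "foldr g w a \<in> A" if "set w \<subseteq> I" for w
      using that a A by (induction w) auto
    have "closedin mtopology A"
      using assms(2) by (simp add: compactin_imp_closedin_gen Hausdorff_imp_kc_space Hausdorff_space_mtopology)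
    moreover have "\<not> disjnt A (mball y r)" if r: "0 < r" for r
    proof -
      obtain k where "l ^ k * D < r"
        using power_l_D_small[OF r] .
      then have "foldr g (stake k s) a \<in> mball y r"
        using foldr_near_code[OF s(1), of a k] inA[OF stake_in[OF s(1)]] AY a code_in[OF s(1)] s
        by (auto simp: commute subset_iff)
      then show ?thesis
        using inA[OF stake_in[OF s(1)]] by (auto simp: disjnt_iff)
    qed
    ultimately show "y \<in> A"
      using code_in[OF s(1)] s(2) unfolding closedin_metric by blast
  qed
qed

lemma set_attractor_eq: "set_attractor Y d I g = attractor"
  unfolding set_attractor_def
proof (rule the_equality)
  show "attractor \<noteq> {} \<and> compactin mtopology attractor \<and> attractor = (\<Union>i\<in>I. g i ` attractor)"
    using some_code compactin_attractor attractor_invariant by (auto simp: attractor_def)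
qed (use attractor_unique in blast)

section \<open>The Bernoulli measure on addresses and its image, the measure attractor\<close>

definition index_law :: "'i measure" where
  "index_law = point_measure I (\<lambda>i. ennreal (Q i))"

lemma space_index_law [simp]: "space index_law = I"
  by (simp add: index_law_def space_point_measure)

lemma sets_index_law [simp, measurable_cong]: "sets index_law = sets (count_space I)"
  by (simp add: index_law_def sets_point_measure)

sublocale index_law: prob_space index_law
  unfolding index_law_def
  by (rule prob_space_point_measure) (use finite_I Q_nonneg Q_sum in \<open>simp_all add: sum_ennreal\<close>)

sublocale stream_law: prob_space "stream_space index_law"
  by (rule index_law.prob_space_stream_space)

lemma scylinder_stake:
  assumes "s \<in> streams I"
  shows "s \<in> scylinder I (map (\<lambda>i. {i}) w) \<longleftrightarrow> stake (length w) s = w"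
  using assms by (induction w arbitrary: s) (auto intro: streams_stl)

lemma measurable_stake_eq:
  assumes "set w \<subseteq> I"
  shows "{s \<in> streams I. stake (length w) s = w} \<in> sets (stream_space index_law)"
proof -
  have "scylinder (space index_law) (map (\<lambda>i. {i}) w) \<in> sets (stream_space index_law)"
    using assms by (intro sets_scylinder) auto
  moreover have "scylinder I (map (\<lambda>i. {i}) w) = {s \<in> streams I. stake (length w) s = w}"
    using scylinder_stake scylinder_streams by blast
  ultimately show ?thesis
    by simp
qed

text \<open>The preimage of an open set is the union of the cylinders of all words whose every
  extension codes into that set. There are only countably many words, so the union is measurable for
  the product sigma-algebra.\<close>

lemma measurable_code [measurable]: "code \<in> measurable (stream_space index_law) (borel_of mtopology)"
proof (rule measurable_borel_ofI)
  show "code s \<in> topspace mtopology" if "s \<in> space (stream_space index_law)" for s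
    using that by (simp add: space_stream_space code_in)
  fix U assume U: "openin mtopology U"
  let ?W = "{w \<in> lists I. \<forall>s\<in>streams I. code (w @- s) \<in> U}"
  have "{s \<in> streams I. code s \<in> U} = (\<Union>w\<in>?W. {s \<in> streams I. stake (length w) s = w})"
  proof (intro equalityI subsetI)
    fix s assume "s \<in> {s \<in> streams I. code s \<in> U}"
    then have s: "s \<in> streams I" "code s \<in> U"
      by auto
    then obtain r where r: "0 < r" "mball (code s) r \<subseteq> U"
      using U by (auto simp: openin_mtopology)
    obtain k where k: "l ^ k * D < r"
      using power_l_D_small[OF r(1)] .
    have "code (stake k s @- t) \<in> U" if t: "t \<in> streams I" for t
    proof -
      have t': "stake k s @- t \<in> streams I"
        using t stake_in[OF s(1)] by (intro shift_streams) auto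
      have "stake k s = stake k (stake k s @- t)"
        by (simp add: stake_shift)
      then have "code (stake k s @- t) \<in> mball (code s) r"
        using code_near_code[OF s(1) t', of k] k code_in s t' by simp
      then show ?thesis
        using r by blast
    qed
    then have "stake k s \<in> ?W"
      using stake_in[OF s(1)] by (auto simp: lists_eq_set)
    moreover have "stake (length (stake k s)) s = stake k s"
      by simp
    ultimately show "s \<in> (\<Union>w\<in>?W. {s \<in> streams I. stake (length w) s = w})"
      using s(1) by blast
  next
    fix s assume "s \<in> (\<Union>w\<in>?W. {s \<in> streams I. stake (length w) s = w})"
    then obtain w where w: "\<forall>t\<in>streams I. code (w @- t) \<in> U" "s \<in> streams I" "stake (length w) s = w"
      by auto
    then show "s \<in> {s \<in> streams I. code s \<in> U}"
      using stake_sdrop[of "length w" s] sdrop_in[OF w(2), of "length w"] by auto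
  qed
  also have "\<dots> \<in> sets (stream_space index_law)"
  proof (rule sets.countable_UN')
    show "countable ?W"
      by (rule countable_subset[OF _ countable_lists[OF countable_finite[OF finite_I]]]) blast
  qed (use measurable_stake_eq in \<open>auto simp: lists_eq_set\<close>)
  finally show "{s \<in> space (stream_space index_law). code s \<in> U} \<in> sets (stream_space index_law)"
    by (simp add: space_stream_space)
qed

lemma continuous_map_g:
  assumes "i \<in> I"
  shows "continuous_map mtopology mtopology (g i)"
proof (subst metric_continuous_map, unfold_locales, intro conjI ballI allI impI)
  show "g i ` Y \<subseteq> Y"
    using g_in assms by auto
  fix a and \<epsilon> :: real
  assume "a \<in> Y" "0 < \<epsilon>"
  have "d (g i a) (g i x) < \<epsilon>" if "x \<in> Y" "d a x < \<epsilon>" for x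
  proof -
    have "d (g i a) (g i x) \<le> l * d a x"
      using g_contraction assms \<open>a \<in> Y\<close> that by blast
    also have "\<dots> \<le> d a x"
      using l by (intro mult_left_le_one_le) auto
    finally show ?thesis
      using that by simp
  qed
  then show "\<exists>\<delta>>0. \<forall>x. x \<in> Y \<and> d a x < \<delta> \<longrightarrow> d (g i a) (g i x) < \<epsilon>"
    using \<open>0 < \<epsilon>\<close> by blast
qed

lemma measurable_g: "i \<in> I \<Longrightarrow> g i \<in> measurable (borel_of mtopology) (borel_of mtopology)"
  by (intro continuous_map_measurable_borel_of continuous_map_g)

definition attractor_law :: "'b measure" where
  "attractor_law = distr (stream_space index_law) (borel_of mtopology) code"

lemma sets_attractor_law [simp, measurable_cong]: "sets attractor_law = sets (borel_of mtopology)"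
  by (simp add: attractor_law_def)

lemma space_attractor_law [simp]: "space attractor_law = Y"
  by (simp add: attractor_law_def)

sublocale attractor_law: prob_space attractor_law
  unfolding attractor_law_def by (intro stream_law.prob_space_distr measurable_code)

text \<open>Prepending an independent letter of law \<open>Q\<close> preserves the law of the
  stream, and \<open>code\<close> turns prepending \<open>i\<close> into applying
  \<open>g i\<close>.\<close>

lemma attractor_law_invariant:
  "attractor_law = mixture (borel_of mtopology) I Q (\<lambda>i. distr attractor_law (borel_of mtopology) (g i))"
proof (rule mixture_eqI[OF finite_I])
  fix B assume B: "B \<in> sets (borel_of mtopology)"
  let ?X = "code -` B \<inter> space (stream_space index_law)"
  have "emeasure attractor_law B = emeasure (stream_space index_law) ?X"
    using B by (simp add: attractor_law_def emeasure_distr)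
  also have "\<dots> = (\<integral>\<^sup>+i. emeasure (stream_space index_law) {s \<in> space (stream_space index_law). i ## s \<in> ?X} \<partial>index_law)"
    using B by (intro index_law.emeasure_stream_space) measurable
  also have "\<dots> = (\<Sum>i\<in>I. ennreal (Q i) * emeasure (stream_space index_law) {s \<in> space (stream_space index_law). i ## s \<in> ?X})"
    unfolding index_law_def by (rule nn_integral_point_measure_finite[OF finite_I])
  also have "\<dots> = (\<Sum>i\<in>I. ennreal (Q i) * emeasure (distr attractor_law (borel_of mtopology) (g i)) B)"
  proof (intro sum.cong refl arg_cong2[where f = "(*)"])
    fix i assume i: "i \<in> I"
    have "{s \<in> space (stream_space index_law). i ## s \<in> ?X} = code -` (g i -` B \<inter> Y) \<inter> space (stream_space index_law)"
      using i by (auto simp: space_stream_space code_Stream code_in streams_Stream)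
    moreover have "g i -` B \<inter> Y \<in> sets (borel_of mtopology)"
      using measurable_sets[OF measurable_g[OF i] B] by simp
    ultimately show "emeasure (stream_space index_law) {s \<in> space (stream_space index_law). i ## s \<in> ?X}
        = emeasure (distr attractor_law (borel_of mtopology) (g i)) B"
      using B measurable_g[OF i]
      by (subst emeasure_distr) (simp_all add: attractor_law_def emeasure_distr)
  qed
  finally show "emeasure attractor_law B
      = (\<Sum>i\<in>I. ennreal (Q i) * emeasure (distr attractor_law (borel_of mtopology) (g i)) B)" .
qed simp_all

lemma lipschitz_fun_compose_g:
  assumes "lipschitz_fun L h" "i \<in> I"
  shows "lipschitz_fun (L * l) (\<lambda>y. h (g i y))"
proof -
  have "\<bar>h (g i x) - h (g i y)\<bar> \<le> L * l * d x y" if "x \<in> Y" "y \<in> Y" for x y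
  proof -
    have "\<bar>h (g i x) - h (g i y)\<bar> \<le> L * d (g i x) (g i y)"
      using assms that g_in by (auto simp: lipschitz_fun_def)
    also have "\<dots> \<le> L * (l * d x y)"
      using assms that g_contraction by (intro mult_left_mono) (auto simp: lipschitz_fun_def)
    finally show ?thesis
      by simp
  qed
  then show ?thesis
    using assms l by (simp add: lipschitz_fun_def)
qed

text \<open>The base case for uniqueness: an integral against a probability measure is an average of
  values that all lie within \<open>L * D\<close> of \<open>h z\<close>, whatever the
  measure.\<close>

lemma integrable_lipschitz_fun:
  assumes "prob_space \<mu>" "sets \<mu> = sets (borel_of mtopology)" "lipschitz_fun L h" "z \<in> Y"
  shows "integrable \<mu> h" "\<bar>integral\<^sup>L \<mu> h - h z\<bar> \<le> L * D"
proof -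
  interpret prob_space \<mu> by fact
  have sp: "space \<mu> = Y"
    using sets_eq_imp_space_eq[OF assms(2)] by simp
  have near: "\<bar>h y - h z\<bar> \<le> L * D" if "y \<in> Y" for y
  proof -
    have "\<bar>h y - h z\<bar> \<le> L * d y z"
      using assms that by (auto simp: lipschitz_fun_def)
    also have "\<dots> \<le> L * D"
      using assms that diameter by (intro mult_left_mono) (auto simp: lipschitz_fun_def)
    finally show ?thesis .
  qed
  have meas: "h \<in> borel_measurable \<mu>"
    using continuous_map_borel_measurable[OF lipschitz_fun_continuous[OF assms(3)]] assms(2)
    by (metis measurable_cong_sets)
  show int: "integrable \<mu> h"
  proof (rule integrable_const_bound[where B = "\<bar>h z\<bar> + L * D"])
    show "AE x in \<mu>. norm (h x) \<le> \<bar>h z\<bar> + L * D"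
      using near sp by (intro AE_I2) (smt (verit) real_norm_def)
  qed fact
  have "integral\<^sup>L \<mu> h \<le> (\<integral>x. h z + L * D \<partial>\<mu>)" "(\<integral>x. h z - L * D \<partial>\<mu>) \<le> integral\<^sup>L \<mu> h"
    by (intro integral_mono int integrable_const; use near sp in \<open>fastforce simp: abs_le_iff\<close>)+
  then show "\<bar>integral\<^sup>L \<mu> h - h z\<bar> \<le> L * D"
    by (simp add: prob_space)
qed

lemma integral_invariant:
  assumes "prob_space \<mu>" "sets \<mu> = sets (borel_of mtopology)"
    and inv: "\<mu> = mixture (borel_of mtopology) I Q (\<lambda>i. distr \<mu> (borel_of mtopology) (g i))"
    and h: "lipschitz_fun L h"
  shows "integral\<^sup>L \<mu> h = (\<Sum>i\<in>I. Q i * (\<integral>y. h (g i y) \<partial>\<mu>))"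
proof -
  have meas_h: "h \<in> borel_measurable (borel_of mtopology)"
    by (rule continuous_map_borel_measurable[OF lipschitz_fun_continuous[OF h]])
  have meas_g: "g i \<in> measurable \<mu> (borel_of mtopology)" if "i \<in> I" for i
    using measurable_g[OF that] assms(2) measurable_cong_sets by blast
  have "integral\<^sup>L \<mu> h = integral\<^sup>L (mixture (borel_of mtopology) I Q (\<lambda>i. distr \<mu> (borel_of mtopology) (g i))) h"
    using inv by simp
  also have "\<dots> = (\<Sum>i\<in>I. Q i * integral\<^sup>L (distr \<mu> (borel_of mtopology) (g i)) h)"
  proof (rule integral_mixture[OF finite_I _ Q_nonneg meas_h])
    show "integrable (distr \<mu> (borel_of mtopology) (g i)) h" if "i \<in> I" for i
      by (rule integrable_lipschitz_fun[OF prob_space.prob_space_distr[OF assms(1) meas_g[OF that]] _ h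
            code_in[OF some_code]]) simp
  qed simp_all
  also have "\<dots> = (\<Sum>i\<in>I. Q i * (\<integral>y. h (g i y) \<partial>\<mu>))"
    using meas_g meas_h by (intro sum.cong refl) (simp add: integral_distr)
  finally show ?thesis .
qed

text \<open>Invariance moves one application of the maps onto the test function, whose Lipschitz
  constant drops from \<open>L\<close> to \<open>L * l\<close>. After \<open>k\<close> rounds the
  two integrals differ by at most \<open>2 * L * (l ^ k * D)\<close>, which tends to 0.\<close>

lemma invariant_measure_unique:
  assumes \<mu>: "prob_space \<mu>" "sets \<mu> = sets (borel_of mtopology)"
      "\<mu> = mixture (borel_of mtopology) I Q (\<lambda>i. distr \<mu> (borel_of mtopology) (g i))"
    and \<nu>: "prob_space \<nu>" "sets \<nu> = sets (borel_of mtopology)"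
      "\<nu> = mixture (borel_of mtopology) I Q (\<lambda>i. distr \<nu> (borel_of mtopology) (g i))"
  shows "\<mu> = \<nu>"
proof (rule measure_eqI_lipschitz[OF \<mu>(1) \<nu>(1) \<mu>(2) \<nu>(2)])
  have bound: "\<bar>integral\<^sup>L \<mu> h - integral\<^sup>L \<nu> h\<bar> \<le> 2 * L * (l ^ k * D)" if "lipschitz_fun L h" for L h k
    using that
  proof (induction k arbitrary: L h)
    case 0
    have "\<bar>integral\<^sup>L \<mu> h - h (code some_code)\<bar> \<le> L * D" "\<bar>integral\<^sup>L \<nu> h - h (code some_code)\<bar> \<le> L * D"
      using integrable_lipschitz_fun(2)[OF \<mu>(1,2) 0 code_in[OF some_code]]
        integrable_lipschitz_fun(2)[OF \<nu>(1,2) 0 code_in[OF some_code]] by auto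
    then show ?case
      by simp
  next
    case (Suc k)
    have "integral\<^sup>L \<mu> h - integral\<^sup>L \<nu> h = (\<Sum>i\<in>I. Q i * ((\<integral>y. h (g i y) \<partial>\<mu>) - (\<integral>y. h (g i y) \<partial>\<nu>)))"
      using integral_invariant[OF \<mu> Suc.prems] integral_invariant[OF \<nu> Suc.prems]
      by (simp add: sum_subtractf right_diff_distrib)
    also have "\<bar>\<dots>\<bar> \<le> (\<Sum>i\<in>I. \<bar>Q i * ((\<integral>y. h (g i y) \<partial>\<mu>) - (\<integral>y. h (g i y) \<partial>\<nu>))\<bar>)"
      by (rule sum_abs)
    also have "\<dots> \<le> (\<Sum>i\<in>I. Q i * (2 * (L * l) * (l ^ k * D)))"
      using Suc.IH[OF lipschitz_fun_compose_g[OF Suc.prems]] Q_nonneg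
      by (intro sum_mono) (simp add: abs_mult mult_left_mono)
    also have "\<dots> = 2 * L * (l ^ Suc k * D)"
      by (simp add: Q_sum flip: sum_distrib_right)
    finally show ?case .
  qed
  fix L h assume h: "lipschitz_fun L h"
  have "(\<lambda>k. 2 * L * (l ^ k * D)) \<longlonglongrightarrow> 2 * L * (0 * D)"
    using l by (intro tendsto_intros LIMSEQ_power_zero) simp
  then have "\<bar>integral\<^sup>L \<mu> h - integral\<^sup>L \<nu> h\<bar> \<le> 2 * L * (0 * D)"
    by (rule LIMSEQ_le_const) (use bound[OF h] in blast)
  then show "integral\<^sup>L \<mu> h = integral\<^sup>L \<nu> h"
    by simp
qed

lemma measure_attractor_eq: "measure_attractor Y d I g Q = attractor_law"
  unfolding measure_attractor_def Let_def
proof (rule the_equality)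
  show "prob_space attractor_law \<and> sets attractor_law = sets (borel_of mtopology) \<and>
      attractor_law = mixture (borel_of mtopology) I Q (\<lambda>i. distr attractor_law (borel_of mtopology) (g i))"
    using attractor_law_invariant attractor_law.prob_space_axioms by simp
qed (use invariant_measure_unique attractor_law_invariant attractor_law.prob_space_axioms sets_attractor_law in blast)

end

subsection \<open>A law of large numbers for bounded orthogonal variables\<close>

text \<open>Between consecutive squares around \<open>n\<close> lie too few bounded terms to matter:
  at most \<open>2 * m\<close> of them against a denominator of at least \<open>m\<close> squared,
  where \<open>m\<close> is \<open>floor_sqrt n\<close>.\<close>

lemma averages_from_squares:
  fixes x :: "nat \<Rightarrow> real"
  assumes "\<And>k. \<bar>x k\<bar> \<le> 1"
    and lim: "(\<lambda>m. (\<Sum>k<m\<^sup>2. x k) / real (m\<^sup>2)) \<longlonglongrightarrow> 0"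
  shows "(\<lambda>n. (\<Sum>k<n. x k) / real n) \<longlonglongrightarrow> 0"
proof (rule tendsto_rabs_zero_cancel, rule tendsto_sandwich[where f = "\<lambda>_. 0"])
  let ?r = floor_sqrt
  have r: "filterlim ?r at_top sequentially"
    unfolding filterlim_at_top by (meson eventually_sequentiallyI le_floor_sqrtI)
  show "(\<lambda>n. \<bar>(\<Sum>k<(?r n)\<^sup>2. x k) / real ((?r n)\<^sup>2)\<bar> + 2 / real (?r n)) \<longlonglongrightarrow> 0"
    using tendsto_add[OF tendsto_rabs_zero[OF filterlim_compose[OF lim r]]
        filterlim_compose[OF lim_const_over_n[of "2::real"] r]] by simp
  show "\<forall>\<^sub>F n in sequentially. \<bar>(\<Sum>k<n. x k) / real n\<bar>
      \<le> \<bar>(\<Sum>k<(?r n)\<^sup>2. x k) / real ((?r n)\<^sup>2)\<bar> + 2 / real (?r n)"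
    using eventually_ge_at_top[of 1]
  proof eventually_elim
    case (elim n)
    let ?m = "?r n"
    have m: "1 \<le> ?m" "?m\<^sup>2 \<le> n" "n < (Suc ?m)\<^sup>2"
      using elim by (auto simp: le_floor_sqrt_iff Suc_floor_sqrt_power2_gt)
    have "\<bar>\<Sum>k\<in>{?m\<^sup>2..<n}. x k\<bar> \<le> (\<Sum>k\<in>{?m\<^sup>2..<n}. 1)"
      using assms(1) by (intro order_trans[OF sum_abs] sum_mono)
    also have "\<dots> = real (n - ?m\<^sup>2)"
      by simp
    also have "\<dots> \<le> real (2 * ?m)"
      using m by (intro of_nat_mono) (simp add: power2_eq_square)
    also have "\<dots> = 2 * real ?m"
      by simp
    finally have "\<bar>\<Sum>k\<in>{?m\<^sup>2..<n}. x k\<bar> \<le> 2 * real ?m" .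
    moreover have "(\<Sum>k<n. x k) = (\<Sum>k<?m\<^sup>2. x k) + (\<Sum>k\<in>{?m\<^sup>2..<n}. x k)"
      using m by (metis atLeast0LessThan le0 sum.atLeastLessThan_concat)
    ultimately have "\<bar>\<Sum>k<n. x k\<bar> \<le> \<bar>\<Sum>k<?m\<^sup>2. x k\<bar> + 2 * real ?m"
      by linarith
    then have "\<bar>\<Sum>k<n. x k\<bar> / real n \<le> (\<bar>\<Sum>k<?m\<^sup>2. x k\<bar> + 2 * real ?m) / real n"
      by (rule divide_right_mono) simp
    also have "\<dots> \<le> (\<bar>\<Sum>k<?m\<^sup>2. x k\<bar> + 2 * real ?m) / real (?m\<^sup>2)"
      using m elim by (intro divide_left_mono mult_pos_pos) auto
    also have "\<dots> = \<bar>\<Sum>k<?m\<^sup>2. x k\<bar> / real (?m\<^sup>2) + 2 / real ?m"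
      by (simp add: add_divide_distrib power2_eq_square)
    finally show ?case
      by (simp add: abs_divide)
  qed
qed auto

text \<open>Orthogonality gives the partial sums a second moment of at most \<open>n\<close>, hence
  the averages at squares a second moment of at most the reciprocal of the square. These are
  summable, so the squared averages are almost surely summable and tend to 0 along squares;
  \<open>averages_from_squares\<close> fills the gaps. No independence is required, which admits
  overlapping words.\<close>

lemma (in prob_space) orthogonal_averages:
  fixes X :: "nat \<Rightarrow> 'a \<Rightarrow> real"
  assumes [measurable]: "\<And>k. X k \<in> borel_measurable M"
    and bound: "\<And>k \<omega>. \<omega> \<in> space M \<Longrightarrow> \<bar>X k \<omega>\<bar> \<le> 1"
    and orth: "\<And>j k. j < k \<Longrightarrow> expectation (\<lambda>\<omega>. X j \<omega> * X k \<omega>) = 0"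
  shows "AE \<omega> in M. (\<lambda>n. (\<Sum>k<n. X k \<omega>) / real n) \<longlonglongrightarrow> 0"
proof -
  define S where "S n \<omega> = (\<Sum>k<n. X k \<omega>)" for n \<omega>
  have [measurable]: "S n \<in> borel_measurable M" for n
    unfolding S_def by measurable
  have S_bound: "\<bar>S n \<omega>\<bar> \<le> real n" if "\<omega> \<in> space M" for n \<omega>
  proof -
    have "\<bar>S n \<omega>\<bar> \<le> (\<Sum>k<n. 1)"
      unfolding S_def using bound[OF that] by (intro order_trans[OF sum_abs] sum_mono)
    then show ?thesis
      by simp
  qed
  have int_bounded: "integrable M f" if "f \<in> borel_measurable M" "\<And>\<omega>. \<omega> \<in> space M \<Longrightarrow> \<bar>f \<omega>\<bar> \<le> B"
    for f :: "'a \<Rightarrow> real" and B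
    using that by (intro integrable_const_bound[where B = B] AE_I2) auto
  have int_XX: "integrable M (\<lambda>\<omega>. X j \<omega> * X k \<omega>)" for j k
    by (rule int_bounded[of _ 1])
      (use bound in \<open>auto simp: abs_mult intro!: mult_le_one\<close>)
  have int_S2: "integrable M (\<lambda>\<omega>. (S n \<omega>)\<^sup>2)" for n
    by (rule int_bounded[of _ "(real n)\<^sup>2"]) (use S_bound in \<open>auto simp: abs_le_square_iff[symmetric]\<close>)
  have int_SX: "integrable M (\<lambda>\<omega>. S n \<omega> * X n \<omega>)" for n
    unfolding S_def sum_distrib_right by (intro Bochner_Integration.integrable_sum int_XX)
  have ES2: "expectation (\<lambda>\<omega>. (S n \<omega>)\<^sup>2) \<le> real n" for n
  proof (induction n)
    case 0
    then show ?case
      by (simp add: S_def)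
  next
    case (Suc n)
    have "expectation (\<lambda>\<omega>. S n \<omega> * X n \<omega>) = 0"
      unfolding S_def sum_distrib_right using orth
      by (subst Bochner_Integration.integral_sum) (auto intro: int_XX)
    moreover have "(S (Suc n) \<omega>)\<^sup>2 = (S n \<omega>)\<^sup>2 + 2 * (S n \<omega> * X n \<omega>) + X n \<omega> * X n \<omega>" for \<omega>
      by (simp add: S_def power2_eq_square algebra_simps)
    moreover have "X n \<omega> * X n \<omega> \<le> 1" if "\<omega> \<in> space M" for \<omega>
      using mult_le_one[OF bound[OF that, of n] abs_ge_zero bound[OF that, of n]] by simp
    then have "expectation (\<lambda>\<omega>. X n \<omega> * X n \<omega>) \<le> expectation (\<lambda>_. 1)"
      by (intro integral_mono int_XX) simp_all
    ultimately show ?case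
      using Suc by (simp add: int_S2 int_SX int_XX prob_space)
  qed
  \<comment> \<open>The squares start at \<open>Suc m\<close> to keep the denominator
    positive.\<close>
  define Y where "Y m \<omega> = (S ((Suc m)\<^sup>2) \<omega> / real ((Suc m)\<^sup>2))\<^sup>2" for m \<omega>
  have [measurable]: "Y m \<in> borel_measurable M" for m
    unfolding Y_def by measurable
  have EY: "(\<integral>\<^sup>+\<omega>. ennreal (Y m \<omega>) \<partial>M) \<le> ennreal (1 / (real (Suc m))\<^sup>2)" for m
  proof -
    let ?N = "(Suc m)\<^sup>2"
    have Y: "Y m = (\<lambda>\<omega>. (S ?N \<omega>)\<^sup>2 / (real ?N)\<^sup>2)"
      by (simp add: Y_def power_divide fun_eq_iff)
    have "(\<integral>\<^sup>+\<omega>. ennreal (Y m \<omega>) \<partial>M) = ennreal (expectation (Y m))"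
      unfolding Y by (intro nn_integral_eq_integral Bochner_Integration.integrable_divide int_S2) auto
    also have "expectation (Y m) = expectation (\<lambda>\<omega>. (S ?N \<omega>)\<^sup>2) / (real ?N)\<^sup>2"
      unfolding Y by simp
    also have "\<dots> \<le> real ?N / (real ?N)\<^sup>2"
      by (intro divide_right_mono ES2) simp
    also have "\<dots> = 1 / real ?N"
      unfolding power2_eq_square[of "real ?N"] by (simp del: of_nat_Suc of_nat_power)
    also have "\<dots> = 1 / (real (Suc m))\<^sup>2"
      by (simp only: of_nat_power)
    finally show ?thesis
      by (simp add: ennreal_leI)
  qed
  have "(\<integral>\<^sup>+\<omega>. (\<Sum>m. ennreal (Y m \<omega>)) \<partial>M) = (\<Sum>m. \<integral>\<^sup>+\<omega>. ennreal (Y m \<omega>) \<partial>M)"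
    by (rule nn_integral_suminf) simp
  also have "\<dots> \<le> (\<Sum>m. ennreal (1 / (real (Suc m))\<^sup>2))"
    by (intro suminf_le EY) auto
  also have "\<dots> < \<infinity>"
  proof -
    have "summable (\<lambda>m. 1 / (real (Suc m))\<^sup>2)"
      using inverse_power_summable[of 2, where 'a = real]
      by (subst summable_Suc_iff[of "\<lambda>m. 1 / (real m)\<^sup>2"]) (simp add: inverse_eq_divide)
    then show ?thesis
      by (simp add: suminf_ennreal2 less_top[symmetric])
  qed
  finally have "AE \<omega> in M. (\<Sum>m. ennreal (Y m \<omega>)) \<noteq> \<infinity>"
    by (intro nn_integral_PInf_AE) auto
  then show ?thesis
    using AE_space
  proof eventually_elim
    case (elim \<omega>)
    have "summable (\<lambda>m. Y m \<omega>)"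
      using elim by (intro summable_suminf_not_top) (auto simp: Y_def)
    then have "(\<lambda>m. sqrt (Y m \<omega>)) \<longlonglongrightarrow> sqrt 0"
      by (intro tendsto_real_sqrt summable_LIMSEQ_zero)
    then have "(\<lambda>m. S ((Suc m)\<^sup>2) \<omega> / real ((Suc m)\<^sup>2)) \<longlonglongrightarrow> 0"
      unfolding Y_def by (simp only: real_sqrt_abs real_sqrt_zero tendsto_rabs_zero_iff)
    then have "(\<lambda>m. S (m\<^sup>2) \<omega> / real (m\<^sup>2)) \<longlonglongrightarrow> 0"
      by (rule LIMSEQ_imp_Suc)
    then show ?case
      unfolding S_def using bound elim by (intro averages_from_squares)
  qed
qed

text \<open>The word is read backwards in time, from position \<open>k - 1\<close> downwards,
  because the newest map of an orbit is outermost and \<open>foldr g w\<close> applies the head of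
  \<open>w\<close> last. Near the start of time, where the past is too short, the match
  fails.\<close>

primrec match :: "(nat \<Rightarrow> 'i) \<Rightarrow> nat \<Rightarrow> 'i list \<Rightarrow> bool" where
  "match x k [] \<longleftrightarrow> True"
| "match x k (i # w) \<longleftrightarrow> 0 < k \<and> x (k - 1) = i \<and> match x (k - 1) w"

lemma match_unique: "match x k w \<Longrightarrow> match x k w' \<Longrightarrow> length w = length w' \<Longrightarrow> w = w'"
proof (induction w arbitrary: k w')
  case (Cons i w)
  then show ?case
    by (cases w') auto
qed simp

text \<open>Together with \<open>match_unique\<close>: from time \<open>j\<close> on, exactly one
  word of length \<open>j\<close> matches, so a sum over words weighted by matches selects a single
  value.\<close>

lemma match_exists:
  assumes "\<And>k. x k \<in> I" "j \<le> k"
  shows "\<exists>w. set w \<subseteq> I \<and> length w = j \<and> match x k w"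
  using assms(2)
proof (induction j arbitrary: k)
  case (Suc j)
  then obtain w where "set w \<subseteq> I" "length w = j" "match x (k - 1) w"
    by (metis Suc_le_mono Suc_pred diff_Suc_1 le_0_eq not_gr_zero nat.distinct(1))
  then show ?case
    using Suc.prems assms(1) by (intro exI[of _ "x (k - 1) # w"]) auto
qed simp

lemma match_length: "match x k w \<Longrightarrow> length w \<le> k"
  by (induction w arbitrary: k) force+

lemma match_cong: "(\<And>j. j < k \<Longrightarrow> x j = y j) \<Longrightarrow> match x k w = match y k w"
  by (induction w arbitrary: k) auto

text \<open>A match at time \<open>k\<close> depends only on coordinates below \<open>k\<close>.
  Measurability over that block of coordinates lets it be separated from the independent variable at
  \<open>k\<close>.\<close>

lemma measurable_match:
  assumes "k \<le> m"
  shows "Measurable.pred (Pi\<^sub>M {..<m} (\<lambda>_. count_space I)) (\<lambda>x. match x k w)"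
  using assms
proof (induction w arbitrary: k)
  case (Cons i w)
  show ?case
  proof (cases k)
    case (Suc j)
    have "Measurable.pred (Pi\<^sub>M {..<m} (\<lambda>_. count_space I)) (\<lambda>x. x j = i)"
      using Cons.prems Suc
      by (intro measurable_compose[OF measurable_component_singleton[of j "{..<m}" "\<lambda>_. count_space I"]]) auto
    then show ?thesis
      using Cons Suc by simp
  qed simp
qed simp

section \<open>Frequencies of words in an independent sequence\<close>

context prob_space
begin

text \<open>The term at \<open>k\<close> is a centred function of \<open>X k\<close> times a
  function of the variables before \<open>k\<close>, so the terms are martingale differences and
  pairwise orthogonal.\<close>

lemma match_averages_difference:
  fixes X :: "nat \<Rightarrow> 'a \<Rightarrow> 'i"
  assumes I: "indep_vars (\<lambda>_. count_space I) X UNIV" and i: "i \<in> I"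
    and law: "\<And>k. prob {\<omega> \<in> space M. X k \<omega> = i} = q"
  shows "AE \<omega> in M. (\<lambda>n. (\<Sum>k<n. (of_bool (X k \<omega> = i) - q) * of_bool (match (\<lambda>j. X j \<omega>) k w)) / real n)
    \<longlonglongrightarrow> 0"
proof (rule orthogonal_averages)
  have rv: "X k \<in> measurable M (count_space I)" for k
    using I by (auto simp: indep_vars_def)
  have X_eq [measurable]: "Measurable.pred M (\<lambda>\<omega>. X k \<omega> = i)" for k
    by (rule measurable_compose[OF rv]) simp
  have q: "0 \<le> q" "q \<le> 1"
    using law[of 0] measure_nonneg prob_le_1 by metis+
  have restrict_rv: "(\<lambda>\<omega>. \<lambda>j\<in>{..<k}. X j \<omega>) \<in> measurable M (Pi\<^sub>M {..<k} (\<lambda>_. count_space I))" for k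
    using rv by (intro measurable_restrict)
  have match_rv [measurable]: "Measurable.pred M (\<lambda>\<omega>. match (\<lambda>j. X j \<omega>) k w)" for k
  proof -
    have "Measurable.pred M (\<lambda>\<omega>. match (\<lambda>j\<in>{..<k}. X j \<omega>) k w)"
      by (rule measurable_compose[OF restrict_rv measurable_match]) simp
    moreover have "match (\<lambda>j\<in>{..<k}. X j \<omega>) k w = match (\<lambda>j. X j \<omega>) k w" for \<omega>
      by (rule match_cong) simp
    ultimately show ?thesis
      by simp
  qed
  define Z where "Z k x = (of_bool (x k = i) - q) * of_bool (match x k w)" for k and x :: "nat \<Rightarrow> 'i"
  have [measurable]: "(\<lambda>\<omega>. Z k (\<lambda>j. X j \<omega>)) \<in> borel_measurable M" for k
    unfolding Z_def by measurable
  then show "(\<lambda>\<omega>. (of_bool (X k \<omega> = i) - q) * of_bool (match (\<lambda>j. X j \<omega>) k w)) \<in> borel_measurable M" for k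
    unfolding Z_def .
  have Z_bound: "\<bar>Z k x\<bar> \<le> 1" for k x
    using q by (simp add: Z_def)
  then show "\<bar>(of_bool (X k \<omega> = i) - q) * of_bool (match (\<lambda>j. X j \<omega>) k w)\<bar> \<le> 1" for k \<omega>
    unfolding Z_def .
  fix j k :: nat assume "j < k"
  \<comment> \<open>For \<open>j < k\<close> the product of the terms at \<open>j\<close> and
    \<open>k\<close> splits into \<open>G\<close>, which sees only times below \<open>k\<close>, and
    the centred factor \<open>H\<close>, which sees only time \<open>k\<close> and has mean
    0.\<close>
  define G where "G x = Z j x * of_bool (match x k w)" for x
  define H where "H x = of_bool (x k = i) - q" for x :: "nat \<Rightarrow> 'i"
  let ?A = "\<lambda>\<omega>. restrict (\<lambda>i. X i \<omega>) {..<k}" and ?B = "\<lambda>\<omega>. restrict (\<lambda>i. X i \<omega>) {k}"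
  have "indep_var (Pi\<^sub>M {..<k} (\<lambda>_. count_space I)) ?A (Pi\<^sub>M {k} (\<lambda>_. count_space I)) ?B"
    using I by (rule indep_var_restrict) auto
  moreover have "G \<in> borel_measurable (Pi\<^sub>M {..<k} (\<lambda>_. count_space I))"
  proof -
    have "Measurable.pred (Pi\<^sub>M {..<k} (\<lambda>_. count_space I)) (\<lambda>x. x j = i)"
      using \<open>j < k\<close>
      by (intro measurable_compose[OF measurable_component_singleton[of j "{..<k}" "\<lambda>_. count_space I"]]) auto
    moreover note measurable_match[of j k w I] measurable_match[of k k w I]
    ultimately show ?thesis
      unfolding G_def Z_def using \<open>j < k\<close> by simp
  qed
  moreover have "H \<in> borel_measurable (Pi\<^sub>M {k} (\<lambda>_. count_space I))"
    unfolding H_def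
    by (intro measurable_compose[OF measurable_component_singleton[of k "{k}" "\<lambda>_. count_space I"]]) auto
  ultimately have "indep_var borel (G \<circ> ?A) borel (H \<circ> ?B)"
    by (rule indep_var_compose)
  moreover have "G \<circ> ?A = (\<lambda>\<omega>. G (\<lambda>j. X j \<omega>))"
  proof
    fix \<omega>
    have "match (?A \<omega>) j w = match (\<lambda>j. X j \<omega>) j w" "match (?A \<omega>) k w = match (\<lambda>j. X j \<omega>) k w"
      using \<open>j < k\<close> by (auto intro!: match_cong)
    then show "(G \<circ> ?A) \<omega> = G (\<lambda>j. X j \<omega>)"
      using \<open>j < k\<close> by (simp add: G_def Z_def)
  qed
  moreover have "H \<circ> ?B = (\<lambda>\<omega>. H (\<lambda>j. X j \<omega>))"
    by (simp add: H_def fun_eq_iff)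
  ultimately have indep: "indep_var borel (\<lambda>\<omega>. G (\<lambda>j. X j \<omega>)) borel (\<lambda>\<omega>. H (\<lambda>j. X j \<omega>))"
    by simp
  have int_G: "integrable M (\<lambda>\<omega>. G (\<lambda>j. X j \<omega>))"
    unfolding G_def by (rule integrable_const_bound[where B = 1]) (use Z_bound in \<open>auto simp: abs_mult\<close>)
  have int_H: "integrable M (\<lambda>\<omega>. H (\<lambda>j. X j \<omega>))"
    unfolding H_def by (rule integrable_const_bound[where B = 1]) (use q in auto)
  have "expectation (\<lambda>\<omega>. of_bool (X k \<omega> = i)) = expectation (indicator {\<omega> \<in> space M. X k \<omega> = i})"
    by (intro Bochner_Integration.integral_cong) (auto simp: indicator_def)
  also have "\<dots> = q"
    using law[of k] by (simp add: Int_def conj_commute cong: conj_cong)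
  finally have "expectation (\<lambda>\<omega>. H (\<lambda>j. X j \<omega>)) = 0"
    unfolding H_def by (subst Bochner_Integration.integral_diff)
      (auto simp: prob_space intro!: integrable_const_bound[where B = 1])
  then have "expectation (\<lambda>\<omega>. G (\<lambda>j. X j \<omega>) * H (\<lambda>j. X j \<omega>)) = 0"
    using indep_var_lebesgue_integral[OF indep int_G int_H] by simp
  then show "expectation (\<lambda>\<omega>. (of_bool (X j \<omega> = i) - q) * of_bool (match (\<lambda>j. X j \<omega>) j w) *
      ((of_bool (X k \<omega> = i) - q) * of_bool (match (\<lambda>j. X j \<omega>) k w))) = 0"
    by (simp add: G_def H_def Z_def mult_ac)
qed

text \<open>Induction on the word: \<open>i # w\<close> matches at \<open>k + 1\<close> iff
  \<open>X k = i\<close> and \<open>w\<close> matches at \<open>k\<close>. Replacing the indicator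
  of \<open>X k = i\<close> by \<open>Q i\<close> changes the average by a null sequence according
  to \<open>match_averages_difference\<close>.\<close>

lemma match_frequency:
  fixes X :: "nat \<Rightarrow> 'a \<Rightarrow> 'i"
  assumes I: "indep_vars (\<lambda>_. count_space I) X UNIV"
    and law: "\<And>k i. i \<in> I \<Longrightarrow> prob {\<omega> \<in> space M. X k \<omega> = i} = Q i"
    and "set w \<subseteq> I"
  shows "AE \<omega> in M. (\<lambda>n. (\<Sum>k<n. of_bool (match (\<lambda>j. X j \<omega>) k w)) / real n) \<longlonglongrightarrow> prod_list (map Q w)"
  using assms(3)
proof (induction w)
  case Nil
  have "(\<lambda>n. real n / real n) \<longlonglongrightarrow> 1"
    by (rule tendsto_eventually) (use eventually_gt_at_top[of 0] in \<open>auto elim: eventually_mono\<close>)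
  then show ?case
    by simp
next
  case (Cons i w)
  have "i \<in> I" "set w \<subseteq> I"
    using Cons.prems by auto
  have "AE \<omega> in M. (\<lambda>n. (\<Sum>k<n. of_bool (match (\<lambda>j. X j \<omega>) k w)) / real n) \<longlonglongrightarrow> prod_list (map Q w)"
    by (rule Cons.IH) fact
  moreover have "AE \<omega> in M. (\<lambda>n. (\<Sum>k<n. (of_bool (X k \<omega> = i) - Q i) * of_bool (match (\<lambda>j. X j \<omega>) k w)) / real n) \<longlonglongrightarrow> 0"
    by (rule match_averages_difference[OF I \<open>i \<in> I\<close> law[OF \<open>i \<in> I\<close>]])
  ultimately show ?case
  proof eventually_elim
    case (elim \<omega>)
    let ?x = "\<lambda>j. X j \<omega>"
    let ?F = "\<lambda>n. (\<Sum>k<n. of_bool (match ?x k w)) / real n"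
      and ?D = "\<lambda>n. (\<Sum>k<n. (of_bool (X k \<omega> = i) - Q i) * of_bool (match ?x k w)) / real n"
    \<comment> \<open>A nonempty word never matches at time 0, so the sum can be shifted by one; the
      factor \<open>n / (n + 1)\<close> corrects the normalisation.\<close>
    have eq: "(\<Sum>k<Suc n. of_bool (match ?x k (i # w))) / real (Suc n)
        = (?D n + Q i * ?F n) * (real n / real (Suc n))" for n
    proof -
      have "(\<Sum>k<Suc n. of_bool (match ?x k (i # w))) = (\<Sum>k<n. of_bool (X k \<omega> = i) * of_bool (match ?x k w) :: real)"
        by (subst sum.lessThan_Suc_shift) (simp add: of_bool_conj)
      also have "\<dots> = (\<Sum>k<n. (of_bool (X k \<omega> = i) - Q i) * of_bool (match ?x k w)) + Q i * (\<Sum>k<n. of_bool (match ?x k w))"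
        by (simp add: left_diff_distrib sum_subtractf sum_distrib_left)
      finally have *: "(\<Sum>k<Suc n. of_bool (match ?x k (i # w))) = \<dots>" .
      show ?thesis
      proof (cases "n = 0")
        case False
        have eq: "(a + q * c) / s = (a / r + q * (c / r)) * (r / s)" if "r \<noteq> 0" "s \<noteq> 0" for a c q r s :: real
          using that by (simp add: field_simps)
        show ?thesis
          unfolding * by (rule eq) (use False in simp_all)
      qed simp
    qed
    have "(\<lambda>n. (?D n + Q i * ?F n) * (real n / real (Suc n))) \<longlonglongrightarrow> (0 + Q i * prod_list (map Q w)) * 1"
      using elim by (intro tendsto_intros LIMSEQ_n_over_Suc_n)
    then have "(\<lambda>n. (\<Sum>k<Suc n. of_bool (match ?x k (i # w))) / real (Suc n)) \<longlonglongrightarrow> prod_list (map Q (i # w))"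
      unfolding eq by simp
    then show ?case
      by (rule LIMSEQ_imp_Suc)
  qed
qed

end

section \<open>Averages of a test function along an orbit\<close>

context coded_ifs
begin

text \<open>This identifies the limiting frequencies of \<open>match_frequency\<close> with the
  probabilities of cylinders, the link between the orbit and \<open>attractor_law\<close>.\<close>

lemma prob_stake_eq:
  "set w \<subseteq> I \<Longrightarrow> stream_law.prob {s \<in> streams I. stake (length w) s = w} = prod_list (map Q w)"
proof (induction w)
  case Nil
  then show ?case
    using stream_law.prob_space by (simp add: space_stream_space)
next
  case (Cons i w)
  let ?E = "\<lambda>w. {s \<in> streams I. stake (length w) s = w}"
  have i: "i \<in> I" "set w \<subseteq> I"
    using Cons.prems by auto
  have "emeasure (stream_space index_law) (?E (i # w))
      = (\<integral>\<^sup>+j. emeasure (stream_space index_law) {s \<in> space (stream_space index_law). j ## s \<in> ?E (i # w)} \<partial>index_law)"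
    by (rule index_law.emeasure_stream_space[OF measurable_stake_eq[OF Cons.prems]])
  also have "\<dots> = (\<Sum>j\<in>I. ennreal (Q j) * emeasure (stream_space index_law) {s \<in> space (stream_space index_law). j ## s \<in> ?E (i # w)})"
    unfolding index_law_def by (rule nn_integral_point_measure_finite[OF finite_I])
  also have "\<dots> = (\<Sum>j\<in>I. if j = i then ennreal (Q i) * emeasure (stream_space index_law) (?E w) else 0)"
    by (intro sum.cong refl)
      (auto simp: space_stream_space streams_Stream intro!: arg_cong2[where f = "(*)"] arg_cong2[where f = emeasure])
  also have "\<dots> = ennreal (Q i * stream_law.prob (?E w))"
    using i finite_I Q_nonneg by (simp add: stream_law.emeasure_eq_measure ennreal_mult)
  finally have "stream_law.prob (?E (i # w)) = Q i * stream_law.prob (?E w)"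
    using Q_nonneg i by (simp add: stream_law.emeasure_eq_measure)
  then show ?case
    using Cons.IH[OF i(2)] by simp
qed

text \<open>The point \<open>y\<close> ranges over all of \<open>Y\<close> because an orbit may
  start, and remain, off the attractor. The bound \<delta> is a Lebesgue number of the cover of the
  compact attractor by preimages of balls of radius \<open>\<epsilon> / 2\<close>.\<close>

lemma uniform_near_attractor:
  assumes h: "continuous_map mtopology euclideanreal h" and "0 < \<epsilon>"
  obtains \<delta> where "0 < \<delta>" "\<And>z y. z \<in> attractor \<Longrightarrow> y \<in> Y \<Longrightarrow> d z y < \<delta> \<Longrightarrow> \<bar>h z - h y\<bar> < \<epsilon>"
proof -
  let ?U = "\<lambda>c. {y \<in> Y. h y \<in> ball c (\<epsilon> / 2)}"
  have open_U: "openin mtopology (?U c)" for c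
    using openin_continuous_map_preimage[OF h, of "ball c (\<epsilon> / 2)"] by simp
  have "attractor \<subseteq> \<Union> (range ?U)"
  proof
    fix z assume "z \<in> attractor"
    then have "z \<in> ?U (h z)"
      using attractor_subset \<open>0 < \<epsilon>\<close> by auto
    then show "z \<in> \<Union> (range ?U)"
      by blast
  qed
  then obtain \<delta> where \<delta>: "0 < \<delta>" "\<forall>z\<in>attractor. \<exists>U\<in>range ?U. mball z \<delta> \<subseteq> U"
    using lebesgue_number[OF compactin_attractor, of "range ?U"] open_U by auto
  have "\<bar>h z - h y\<bar> < \<epsilon>" if "z \<in> attractor" "y \<in> Y" "d z y < \<delta>" for z y
  proof -
    obtain c where c: "mball z \<delta> \<subseteq> ?U c"
      using \<delta> \<open>z \<in> attractor\<close> by blast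
    have "z \<in> mball z \<delta>" "y \<in> mball z \<delta>"
      using \<delta>(1) that attractor_subset by (auto simp: subset_iff)
    then have "z \<in> ?U c" "y \<in> ?U c"
      using c by blast+
    then have "\<bar>c - h z\<bar> < \<epsilon> / 2" "\<bar>c - h y\<bar> < \<epsilon> / 2"
      by (auto simp: dist_real_def)
    then show ?thesis
      by linarith
  qed
  then show thesis
    using that \<delta>(1) by blast
qed

lemma match_foldr:
  assumes "\<And>k. y (Suc k) = g (x k) (y k)" "match x k w"
  shows "y k = foldr g w (y (k - length w))"
  using assms(2)
proof (induction w arbitrary: k)
  case (Cons i w)
  then obtain j where "k = Suc j"
    by (cases k) auto
  then show ?case
    using Cons assms(1)[of j] by auto
qed simp

definition words :: "nat \<Rightarrow> 'i list set" where
  "words j = {w. set w \<subseteq> I \<and> length w = j}"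

lemma finite_words: "finite (words j)"
  unfolding words_def by (rule finite_lists_length_eq[OF finite_I])

text \<open>Both the orbit average and the integral are compared with sums over words of length
  \<open>j\<close>: the latest \<open>j\<close> letters locate an orbit point near
  \<open>rep w\<close>, and the first \<open>j\<close> letters of an address locate its coded point
  there as well. The two sums differ only in having frequencies in place of probabilities.\<close>

lemma orbit_averages:
  assumes x: "\<And>k. x k \<in> I" and y0: "y 0 \<in> Y" and y: "\<And>k. y (Suc k) = g (x k) (y k)"
    and freq: "\<And>w. set w \<subseteq> I \<Longrightarrow>
      (\<lambda>n. (\<Sum>k<n. of_bool (match x k w)) / real n) \<longlonglongrightarrow> prod_list (map Q w)"
    and h: "continuous_map mtopology euclideanreal h" and B: "\<And>z. z \<in> Y \<Longrightarrow> \<bar>h z\<bar> \<le> B"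
  shows "(\<lambda>n. (\<Sum>k<n. h (y k)) / real n) \<longlonglongrightarrow> integral\<^sup>L attractor_law h"
proof (rule LIMSEQ_I)
  fix e :: real assume "0 < e"
  \<comment> \<open>Four errors: replacing late orbit points by representatives, the first
    \<open>j\<close> times, frequencies against probabilities, and replacing coded points in the
    integral.\<close>
  define \<epsilon> where "\<epsilon> = e / 4"
  have "0 < \<epsilon>"
    using \<open>0 < e\<close> by (simp add: \<epsilon>_def)
  obtain \<delta> where \<delta>: "0 < \<delta>" "\<And>z y. z \<in> attractor \<Longrightarrow> y \<in> Y \<Longrightarrow> d z y < \<delta> \<Longrightarrow> \<bar>h z - h y\<bar> < \<epsilon>"
    using uniform_near_attractor[OF h \<open>0 < \<epsilon>\<close>] by blast
  obtain j where j: "l ^ j * D < \<delta>"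
    using power_l_D_small[OF \<delta>(1)] .
  \<comment> \<open>The representative is taken on the attractor, since
    \<open>uniform_near_attractor\<close> requires one of the two points to lie there.\<close>
  define rep where "rep w = code (w @- some_code)" for w
  have rep_in: "rep w \<in> attractor" "rep w \<in> Y" if "w \<in> words j" for w
  proof -
    have "w @- some_code \<in> streams I"
      using that some_code by (auto simp: words_def intro: shift_streams)
    then show "rep w \<in> attractor"
      by (simp add: rep_def attractor_def)
    then show "rep w \<in> Y"
      using attractor_subset by blast
  qed
  have near_rep: "\<bar>h (rep w) - h (foldr g w z)\<bar> < \<epsilon>" if "w \<in> words j" "z \<in> Y" for w z
  proof (rule \<delta>(2)[OF rep_in(1)[OF that(1)]])
    have w: "set w \<subseteq> I" "length w = j"
      using that by (auto simp: words_def)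
    show "foldr g w z \<in> Y"
      using foldr_g_in w that by blast
    show "d (rep w) (foldr g w z) < \<delta>"
      using foldr_g_contraction[OF w(1) code_in[OF some_code] that(2)] j w
      by (simp add: rep_def code_shift[OF w(1) some_code])
  qed
  have y_in: "y k \<in> Y" for k
    by (induction k) (auto simp: y0 y x g_in)
  have late: "\<bar>h (y k) - (\<Sum>w\<in>words j. of_bool (match x k w) * h (rep w))\<bar> \<le> \<epsilon>" if jk: "j \<le> k" for k
  proof -
    obtain v where "set v \<subseteq> I" "length v = j" "match x k v"
      using match_exists[of x I j k, OF x jk] by blast
    then have v: "v \<in> words j" "match x k v"
      by (simp_all add: words_def)
    have iff: "match x k w \<longleftrightarrow> w = v" if "w \<in> words j" for w
      using match_unique[of x k v w] v that unfolding words_def by auto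
    have "(\<Sum>w\<in>words j. of_bool (match x k w) * h (rep w)) = (\<Sum>w\<in>words j. if w = v then h (rep v) else 0)"
      using iff by (intro sum.cong refl) simp
    also have "\<dots> = h (rep v)"
      using v finite_words by simp
    finally show ?thesis
      using near_rep[OF v(1) y_in[of "k - length v"]] match_foldr[of y x k v, OF y v(2)]
      by (simp add: abs_minus_commute)
  qed
  \<comment> \<open>Before time \<open>j\<close> no word of length \<open>j\<close> matches, so the
    sum is 0 and only the crude bound \<open>B\<close> remains; these times contribute at most
    \<open>j * B / n\<close> to the average.\<close>
  have early: "\<bar>h (y k) - (\<Sum>w\<in>words j. of_bool (match x k w) * h (rep w))\<bar> \<le> B" if "k < j" for k
  proof -
    have "(\<Sum>w\<in>words j. of_bool (match x k w) * h (rep w)) = 0"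
      using that match_length[of x k] by (intro sum.neutral) (force simp: words_def)
    then show ?thesis
      using B[OF y_in] by simp
  qed
  have "0 \<le> B"
    using B[OF y0] abs_ge_zero order_trans by blast
  define F where "F n = (\<Sum>w\<in>words j. (\<Sum>k<n. of_bool (match x k w)) / real n * h (rep w))" for n
  define F\<^sub>0 where "F\<^sub>0 = (\<Sum>w\<in>words j. prod_list (map Q w) * h (rep w))"
  have "F \<longlonglongrightarrow> F\<^sub>0"
    unfolding F_def F\<^sub>0_def using freq by (intro tendsto_sum tendsto_mult tendsto_const) (auto simp: words_def)
  then have ev_F: "\<forall>\<^sub>F n in sequentially. \<bar>F n - F\<^sub>0\<bar> < \<epsilon>"
    using \<open>0 < \<epsilon>\<close> unfolding tendsto_iff dist_real_def by blast
  have "(\<lambda>n. real j * B / real n) \<longlonglongrightarrow> 0"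
    by (rule lim_const_over_n)
  then have ev_j: "\<forall>\<^sub>F n in sequentially. real j * B / real n < \<epsilon>"
    using \<open>0 < \<epsilon>\<close> by (rule order_tendstoD(2))
  have avg: "\<bar>(\<Sum>k<n. h (y k)) / real n - F n\<bar> \<le> \<epsilon> + real j * B / real n" if "0 < n" for n
  proof -
    have "real n * F n = (\<Sum>w\<in>words j. \<Sum>k<n. of_bool (match x k w) * h (rep w))"
      unfolding F_def sum_distrib_left using that by (intro sum.cong refl) (simp add: sum_distrib_right)
    then have nF: "real n * F n = (\<Sum>k<n. \<Sum>w\<in>words j. of_bool (match x k w) * h (rep w))"
      by (subst sum.swap)
    have "\<bar>(\<Sum>k<n. h (y k)) - real n * F n\<bar>
        \<le> (\<Sum>k<n. \<bar>h (y k) - (\<Sum>w\<in>words j. of_bool (match x k w) * h (rep w))\<bar>)"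
      unfolding nF sum_subtractf[symmetric] by (rule sum_abs)
    also have "\<dots> \<le> (\<Sum>k<n. \<epsilon> + (if k < j then B else 0))"
      using late early \<open>0 < \<epsilon>\<close> \<open>0 \<le> B\<close> by (intro sum_mono) (force simp: not_less)
    also have "\<dots> = real n * \<epsilon> + real (card ({..<n} \<inter> {..<j})) * B"
      by (simp add: sum.distrib sum.If_cases lessThan_def Int_def)
    also have "\<dots> \<le> real n * \<epsilon> + real j * B"
      using \<open>0 \<le> B\<close> card_mono[of "{..<j}" "{..<n} \<inter> {..<j}"] by (intro add_left_mono mult_right_mono) auto
    finally have "\<bar>(\<Sum>k<n. h (y k)) - real n * F n\<bar> / real n \<le> (real n * \<epsilon> + real j * B) / real n"
      by (rule divide_right_mono) simp
    moreover have "\<bar>(\<Sum>k<n. h (y k)) - real n * F n\<bar> / real n = \<bar>(\<Sum>k<n. h (y k)) / real n - F n\<bar>"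
    proof -
      have "((\<Sum>k<n. h (y k)) - real n * F n) / real n = (\<Sum>k<n. h (y k)) / real n - F n"
        using that by (simp add: diff_divide_distrib)
      then show ?thesis
        by (metis abs_divide abs_of_nat)
    qed
    ultimately show ?thesis
      using that by (simp add: add_divide_distrib)
  qed
  have meas_h: "h \<in> borel_measurable (borel_of mtopology)"
    by (rule continuous_map_borel_measurable[OF h])
  have int_code: "integrable (stream_space index_law) (\<lambda>s. h (code s))"
    using meas_h B code_in
    by (intro stream_law.integrable_const_bound[where B = B] AE_I2) (auto simp: space_stream_space)
  \<comment> \<open>On the cylinder of \<open>w\<close> the step function \<open>?G\<close> has the
    value \<open>h (rep w)\<close>, so it is uniformly close to \<open>h\<close> composed with
    \<open>code\<close>, and its integral is exactly \<open>F\<^sub>0\<close>.\<close>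
  have law: "\<bar>integral\<^sup>L attractor_law h - F\<^sub>0\<bar> \<le> \<epsilon>"
  proof -
    let ?E = "\<lambda>w. {s \<in> streams I. stake (length w) s = w}"
    let ?G = "\<lambda>s. \<Sum>w\<in>words j. indicator (?E w) s * h (rep w)"
    have E: "?E w \<in> sets (stream_space index_law)" if "w \<in> words j" for w
      using measurable_stake_eq[of w] that by (auto simp: words_def)
    have int_ind: "integrable (stream_space index_law) (\<lambda>s. indicator (?E w) s * h (rep w))" if "w \<in> words j" for w
      using E[OF that] by (intro integrable_mult_left integrable_real_indicator) (auto simp: stream_law.emeasure_eq_measure)
    have "F\<^sub>0 = (\<Sum>w\<in>words j. (\<integral>s. indicator (?E w) s * h (rep w) \<partial>stream_space index_law))"
      unfolding F\<^sub>0_def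
    proof (intro sum.cong refl)
      fix w assume w: "w \<in> words j"
      have "stream_law.expectation (indicator (?E w)) = stream_law.prob (?E w)"
        using sets.sets_into_space[OF E[OF w]] by (simp add: Int_absorb2)
      then show "prod_list (map Q w) * h (rep w) = (\<integral>s. indicator (?E w) s * h (rep w) \<partial>stream_space index_law)"
        using prob_stake_eq[of w] w by (simp add: words_def)
    qed
    also have "\<dots> = integral\<^sup>L (stream_space index_law) ?G"
      using int_ind by (rule Bochner_Integration.integral_sum[symmetric])
    finally have F0: "F\<^sub>0 = integral\<^sup>L (stream_space index_law) ?G" .
    have int_G: "integrable (stream_space index_law) ?G"
      using int_ind by (rule Bochner_Integration.integrable_sum)
    have near: "\<bar>h (code s) - ?G s\<bar> \<le> \<epsilon>" if s: "s \<in> streams I" for s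
    proof -
      let ?v = "stake j s"
      have v: "?v \<in> words j"
        using stake_in[OF s] by (auto simp: words_def)
      have "?G s = (\<Sum>w\<in>words j. if w = ?v then h (rep ?v) else 0)"
        using s by (intro sum.cong refl) (auto simp: words_def indicator_def)
      also have "\<dots> = h (rep ?v)"
        using v finite_words by simp
      finally have "?G s = h (rep ?v)" .
      moreover have "code s = foldr g ?v (code (sdrop j s))"
        using code_shift[OF stake_in[OF s] sdrop_in[OF s], of j j] by (simp add: stake_sdrop)
      ultimately show ?thesis
        using near_rep[OF v code_in[OF sdrop_in[OF s, of j]]] by simp
    qed
    have "integral\<^sup>L attractor_law h = (\<integral>s. h (code s) \<partial>stream_space index_law)"
      unfolding attractor_law_def by (rule integral_distr[OF measurable_code meas_h])
    then have "integral\<^sup>L attractor_law h - F\<^sub>0 = (\<integral>s. h (code s) - ?G s \<partial>stream_space index_law)"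
      using F0 int_code int_G by simp
    also have "\<bar>\<dots>\<bar> \<le> (\<integral>s. \<bar>h (code s) - ?G s\<bar> \<partial>stream_space index_law)"
      by (rule integral_abs_bound)
    also have "\<dots> \<le> (\<integral>s. \<epsilon> \<partial>stream_space index_law)"
      using near int_code int_G by (intro integral_mono) (auto simp: space_stream_space)
    also have "\<dots> = \<epsilon>"
      by (simp add: stream_law.prob_space)
    finally show ?thesis .
  qed
  have "\<forall>\<^sub>F n in sequentially. norm ((\<Sum>k<n. h (y k)) / real n - integral\<^sup>L attractor_law h) < e"
    using ev_F ev_j eventually_gt_at_top[of 0]
  proof eventually_elim
    case (elim n)
    have "\<bar>(\<Sum>k<n. h (y k)) / real n - integral\<^sup>L attractor_law h\<bar> < 4 * \<epsilon>"
      using elim(1,2) avg[OF elim(3)] law by linarith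
    then show ?case
      by (simp add: \<epsilon>_def)
  qed
  then show "\<exists>n\<^sub>0. \<forall>n\<ge>n\<^sub>0. norm ((\<Sum>k<n. h (y k)) / real n - integral\<^sup>L attractor_law h) < e"
    by (simp add: eventually_sequentially)
qed

end

subsection \<open>The Monge--Kantorovitch metric\<close>

lemma mixture_cong:
  assumes "\<And>i. i \<in> I \<Longrightarrow> p i = q i" "\<And>i. i \<in> I \<Longrightarrow> \<mu> i = \<nu> i"
  shows "mixture S I p \<mu> = mixture S I q \<nu>"
proof -
  have "(\<lambda>B. \<Sum>i\<in>I. ennreal (p i) * emeasure (\<mu> i) B) = (\<lambda>B. \<Sum>i\<in>I. ennreal (q i) * emeasure (\<nu> i) B)"
    using assms by (intro ext sum.cong) auto
  then show ?thesis
    by (simp add: mixture_def)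
qed

lemma lipschitz_on_real_iff: "L-lipschitz_on UNIV h \<longleftrightarrow> Met_TC.lipschitz_fun L h"
  for h :: "'x::metric_space \<Rightarrow> real"
  by (auto simp: lipschitz_on_def Met_TC.lipschitz_fun_def dist_real_def)

lemma lipschitz_borel_measurable:
  assumes "L-lipschitz_on UNIV h" "\<mu> \<in> borel_probs"
  shows "h \<in> borel_measurable \<mu>"
proof -
  have "h \<in> borel_measurable borel"
    by (rule borel_measurable_continuous_onI[OF lipschitz_on_continuous_on[OF assms(1)]])
  then show ?thesis
    using assms(2) measurable_cong_sets unfolding borel_probs_def by blast
qed

text \<open>The parameter \<open>dummy\<close> ties the type \<open>'x\<close> to the context, so
  that its compactness can be assumed once for all lemmas.\<close>

context
  fixes dummy :: "'x::metric_space itself"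
  assumes compact_X: "compact (UNIV :: 'x set)"
begin

lemma dist_le_diameter: "dist x y \<le> diameter (UNIV :: 'x set)" for x y :: 'x
  by (rule diameter_bounded_bound[OF compact_imp_bounded[OF compact_X]]) auto

text \<open>The integral is an average of values within the oscillation of \<open>h\<close>. This
  bounds the supremum in \<open>mk_dist\<close>, without which \<open>Sup\<close> on the reals would
  carry no information.\<close>

lemma integral_near_value:
  fixes h :: "'x \<Rightarrow> real"
  assumes h: "L-lipschitz_on UNIV h" and \<mu>: "\<mu> \<in> borel_probs"
  shows "integrable \<mu> h" "\<bar>integral\<^sup>L \<mu> h - h z\<bar> \<le> L * diameter (UNIV :: 'x set)"
proof -
  interpret prob_space \<mu>
    using \<mu> by (simp add: borel_probs_def)
  have near: "\<bar>h x - h z\<bar> \<le> L * diameter (UNIV :: 'x set)" for x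
  proof -
    have "\<bar>h x - h z\<bar> \<le> L * dist x z"
      using lipschitz_onD[OF h, of x z] by (simp add: dist_real_def)
    also have "\<dots> \<le> L * diameter (UNIV :: 'x set)"
      using h by (intro mult_left_mono dist_le_diameter) (simp add: lipschitz_on_def)
    finally show ?thesis .
  qed
  show int: "integrable \<mu> h"
  proof (rule integrable_const_bound[where B = "\<bar>h z\<bar> + L * diameter (UNIV :: 'x set)"])
    show "AE x in \<mu>. norm (h x) \<le> \<bar>h z\<bar> + L * diameter (UNIV :: 'x set)"
      using near by (intro AE_I2) (smt (verit) real_norm_def)
  qed (rule lipschitz_borel_measurable[OF h \<mu>])
  have "integral\<^sup>L \<mu> h \<le> (\<integral>x. h z + L * diameter (UNIV :: 'x set) \<partial>\<mu>)"
       "(\<integral>x. h z - L * diameter (UNIV :: 'x set) \<partial>\<mu>) \<le> integral\<^sup>L \<mu> h"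
    using near by (intro integral_mono int integrable_const; smt (verit))+
  then show "\<bar>integral\<^sup>L \<mu> h - h z\<bar> \<le> L * diameter (UNIV :: 'x set)"
    by (simp add: prob_space)
qed

lemma mk_dist_set_bounded:
  fixes h :: "'x \<Rightarrow> real"
  assumes "\<mu> \<in> borel_probs" "\<nu> \<in> borel_probs" "1-lipschitz_on UNIV h"
  shows "integral\<^sup>L \<mu> h - integral\<^sup>L \<nu> h \<le> 2 * diameter (UNIV :: 'x set)"
  using integral_near_value(2)[OF assms(3,1), of undefined] integral_near_value(2)[OF assms(3,2), of undefined]
  by linarith

lemma mk_dist_eq:
  "\<mu> \<in> borel_probs \<Longrightarrow> \<nu> \<in> borel_probs \<Longrightarrow>
    mk_dist \<mu> \<nu> = (SUP h \<in> {h :: 'x \<Rightarrow> real. 1-lipschitz_on UNIV h}. integral\<^sup>L \<mu> h - integral\<^sup>L \<nu> h)"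
  unfolding mk_dist_def by (simp add: setcompr_eq_image)

lemma mk_dist_leI:
  fixes \<mu> \<nu> :: "'x measure"
  assumes "\<mu> \<in> borel_probs" "\<nu> \<in> borel_probs"
    and "\<And>h :: 'x \<Rightarrow> real. 1-lipschitz_on UNIV h \<Longrightarrow> integral\<^sup>L \<mu> h - integral\<^sup>L \<nu> h \<le> c"
  shows "mk_dist \<mu> \<nu> \<le> c"
proof -
  have "1-lipschitz_on UNIV (\<lambda>_::'x. 0::real)"
    by (simp add: lipschitz_on_def)
  then show ?thesis
    unfolding mk_dist_eq[OF assms(1,2)] using assms(3) by (intro cSUP_least) auto
qed

lemma integral_diff_le_mk_dist_1:
  fixes h :: "'x \<Rightarrow> real"
  assumes "\<mu> \<in> borel_probs" "\<nu> \<in> borel_probs" "1-lipschitz_on UNIV h"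
  shows "integral\<^sup>L \<mu> h - integral\<^sup>L \<nu> h \<le> mk_dist \<mu> \<nu>"
  unfolding mk_dist_eq[OF assms(1,2)]
  using mk_dist_set_bounded[OF assms(1,2)] assms(3) by (intro cSUP_upper bdd_aboveI2) auto

lemma mk_dist_le_diameter:
  "\<mu> \<in> borel_probs \<Longrightarrow> \<nu> \<in> borel_probs \<Longrightarrow> mk_dist \<mu> \<nu> \<le> 2 * diameter (UNIV :: 'x set)"
  for \<mu> \<nu> :: "'x measure"
  using mk_dist_set_bounded by (intro mk_dist_leI)

text \<open>For positive \<open>L\<close> rescale to \<open>h x / L\<close>. For
  \<open>L = 0\<close> the function is constant and both integrals equal its value.\<close>

lemma integral_diff_le_mk_dist:
  fixes h :: "'x \<Rightarrow> real"
  assumes \<mu>: "\<mu> \<in> borel_probs" and \<nu>: "\<nu> \<in> borel_probs" and h: "L-lipschitz_on UNIV h"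
  shows "integral\<^sup>L \<mu> h - integral\<^sup>L \<nu> h \<le> L * mk_dist \<mu> \<nu>"
proof (cases "L = 0")
  case True
  then show ?thesis
    using integral_near_value(2)[OF h \<mu>, of undefined] integral_near_value(2)[OF h \<nu>, of undefined] by simp
next
  case False
  then have L: "0 < L"
    using h by (simp add: lipschitz_on_def)
  have "1-lipschitz_on UNIV (\<lambda>x. h x / L)"
    using h L by (simp add: lipschitz_on_def dist_real_def divide_le_eq mult.commute flip: diff_divide_distrib)
  from integral_diff_le_mk_dist_1[OF \<mu> \<nu> this] show ?thesis
    using L by (simp add: divide_le_eq mult.commute flip: diff_divide_distrib)
qed

lemma mk_dist_nonneg: "0 \<le> mk_dist \<mu> \<nu>" for \<mu> \<nu> :: "'x measure"
proof (cases "\<mu> \<in> borel_probs \<and> \<nu> \<in> borel_probs")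
  case True
  have "1-lipschitz_on UNIV (\<lambda>_::'x. 0::real)"
    by (simp add: lipschitz_on_def)
  then show ?thesis
    using integral_diff_le_mk_dist_1[of \<mu> \<nu> "\<lambda>_. 0"] True by simp
qed (auto simp: mk_dist_def)

lemma mk_dist_commute: "mk_dist \<mu> \<nu> = mk_dist \<nu> \<mu>" for \<mu> \<nu> :: "'x measure"
proof (cases "\<mu> \<in> borel_probs \<and> \<nu> \<in> borel_probs")
  case True
  have "mk_dist \<mu> \<nu> \<le> mk_dist \<nu> \<mu>" if \<mu>: "\<mu> \<in> borel_probs" and \<nu>: "\<nu> \<in> borel_probs" for \<mu> \<nu> :: "'x measure"
  proof (rule mk_dist_leI[OF \<mu> \<nu>])
    fix h :: "'x \<Rightarrow> real" assume "1-lipschitz_on UNIV h"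
    then have "1-lipschitz_on UNIV (\<lambda>x. - h x)"
      by (simp add: lipschitz_on_def dist_real_def abs_minus_commute)
    from integral_diff_le_mk_dist_1[OF \<nu> \<mu> this]
    show "integral\<^sup>L \<mu> h - integral\<^sup>L \<nu> h \<le> mk_dist \<nu> \<mu>"
      by simp
  qed
  then show ?thesis
    using True by (simp add: antisym)
qed (auto simp: mk_dist_def)

text \<open>Distance 0 forces equal integrals of all Lipschitz functions, and these determine the
  measure. The criterion is used for the type class metric \<open>Met_TC\<close>, whose Borel sets
  are those of \<open>borel\<close>.\<close>

lemma Metric_space_mk_dist: "Metric_space (borel_probs :: 'x measure set) mk_dist"
proof
  fix \<mu> \<nu> \<rho> :: "'x measure"
  show "0 \<le> mk_dist \<mu> \<nu>"
    by (rule mk_dist_nonneg)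
  show "mk_dist \<mu> \<nu> = mk_dist \<nu> \<mu>"
    by (rule mk_dist_commute)
  assume \<mu>: "\<mu> \<in> borel_probs" and \<nu>: "\<nu> \<in> borel_probs"
  show "mk_dist \<mu> \<nu> = 0 \<longleftrightarrow> \<mu> = \<nu>"
  proof
    assume *: "mk_dist \<mu> \<nu> = 0"
    show "\<mu> = \<nu>"
    proof (rule Met_TC.measure_eqI_lipschitz)
      show "prob_space \<mu>" "prob_space \<nu>" "sets \<mu> = sets (borel_of Met_TC.mtopology)"
          "sets \<nu> = sets (borel_of Met_TC.mtopology)"
        using \<mu> \<nu> by (simp_all add: borel_probs_def borel_of_euclidean)
      fix L and h :: "'x \<Rightarrow> real" assume "Met_TC.lipschitz_fun L h"
      then have h: "L-lipschitz_on UNIV h"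
        by (simp add: lipschitz_on_real_iff)
      show "integral\<^sup>L \<mu> h = integral\<^sup>L \<nu> h"
        using integral_diff_le_mk_dist[OF \<mu> \<nu> h] integral_diff_le_mk_dist[OF \<nu> \<mu> h] * mk_dist_commute[of \<mu> \<nu>]
        by simp
    qed
  next
    assume "\<mu> = \<nu>"
    then have "mk_dist \<mu> \<nu> \<le> 0"
      using \<mu> by (intro mk_dist_leI) auto
    then show "mk_dist \<mu> \<nu> = 0"
      using mk_dist_nonneg[of \<mu> \<nu>] by simp
  qed
  assume \<rho>: "\<rho> \<in> borel_probs"
  show "mk_dist \<mu> \<rho> \<le> mk_dist \<mu> \<nu> + mk_dist \<nu> \<rho>"
  proof (rule mk_dist_leI[OF \<mu> \<rho>])
    fix h :: "'x \<Rightarrow> real" assume "1-lipschitz_on UNIV h"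
    from integral_diff_le_mk_dist_1[OF \<mu> \<nu> this] integral_diff_le_mk_dist_1[OF \<nu> \<rho> this]
    show "integral\<^sup>L \<mu> h - integral\<^sup>L \<rho> h \<le> mk_dist \<mu> \<nu> + mk_dist \<nu> \<rho>"
      by simp
  qed
qed

lemma mk_dist_max_leI:
  "1 \<le> V \<Longrightarrow> (\<And>v. v \<in> {1..V} \<Longrightarrow> mk_dist (\<mu> v) (\<nu> v) \<le> c) \<Longrightarrow> mk_dist_max V \<mu> \<nu> \<le> c"
  for \<mu> \<nu> :: "nat \<Rightarrow> 'x measure"
  by (auto simp: mk_dist_max_def)

lemma mk_dist_le_max: "v \<in> {1..V} \<Longrightarrow> mk_dist (\<mu> v) (\<nu> v) \<le> mk_dist_max V \<mu> \<nu>"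
  for \<mu> \<nu> :: "nat \<Rightarrow> 'x measure"
  unfolding mk_dist_max_def by (rule Max_ge) auto

lemma Metric_space_mk_dist_max:
  assumes V: "1 \<le> V"
  shows "Metric_space (prob_tuples V :: (nat \<Rightarrow> 'x measure) set) (mk_dist_max V)"
proof -
  interpret mk: Metric_space "borel_probs :: 'x measure set" mk_dist
    by (rule Metric_space_mk_dist)
  show ?thesis
  proof
    fix \<mu> \<nu> \<rho> :: "nat \<Rightarrow> 'x measure"
    show nonneg: "0 \<le> mk_dist_max V \<mu> \<nu>"
      using order_trans[OF mk_dist_nonneg mk_dist_le_max[of 1 V \<mu> \<nu>]] V by simp
    show "mk_dist_max V \<mu> \<nu> = mk_dist_max V \<nu> \<mu>"
      by (simp add: mk_dist_max_def mk_dist_commute)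
    assume \<mu>: "\<mu> \<in> prob_tuples V" and \<nu>: "\<nu> \<in> prob_tuples V"
    have in_probs: "\<mu> v \<in> borel_probs" "\<nu> v \<in> borel_probs" if "v \<in> {1..V}" for v
      using \<mu> \<nu> that by (auto simp: prob_tuples_def)
    show "mk_dist_max V \<mu> \<nu> = 0 \<longleftrightarrow> \<mu> = \<nu>"
    proof
      assume *: "mk_dist_max V \<mu> \<nu> = 0"
      have "\<mu> v = \<nu> v" if "v \<in> {1..V}" for v
        using mk_dist_le_max[OF that, of \<mu> \<nu>] * mk_dist_nonneg[of "\<mu> v" "\<nu> v"] mk.zero[OF in_probs[OF that]]
        by simp
      then show "\<mu> = \<nu>"
        \<comment> \<open>Agreement on \<open>{1..V}\<close> is enough because tuples are
          extensional.\<close>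
        using \<mu> \<nu> unfolding prob_tuples_def by (rule PiE_ext[rotated 2])
    next
      assume "\<mu> = \<nu>"
      then have "mk_dist_max V \<mu> \<nu> \<le> 0"
        using in_probs V by (intro mk_dist_max_leI) auto
      then show "mk_dist_max V \<mu> \<nu> = 0"
        using nonneg by simp
    qed
    assume \<rho>: "\<rho> \<in> prob_tuples V"
    show "mk_dist_max V \<mu> \<rho> \<le> mk_dist_max V \<mu> \<nu> + mk_dist_max V \<nu> \<rho>"
    proof (rule mk_dist_max_leI[OF V])
      fix v assume v: "v \<in> {1..V}"
      have "mk_dist (\<mu> v) (\<rho> v) \<le> mk_dist (\<mu> v) (\<nu> v) + mk_dist (\<nu> v) (\<rho> v)"
        using in_probs[OF v] \<rho> v by (intro mk.triangle) (auto simp: prob_tuples_def)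
      also have "\<dots> \<le> mk_dist_max V \<mu> \<nu> + mk_dist_max V \<nu> \<rho>"
        by (intro add_mono mk_dist_le_max v)
      finally show "mk_dist (\<mu> v) (\<rho> v) \<le> mk_dist_max V \<mu> \<nu> + mk_dist_max V \<nu> \<rho>" .
    qed
  qed
qed

end

subsection \<open>The coding map of a superIFS\<close>

text \<open>The weights \<open>Q\<close> are arbitrary here, since the claim on component sets
  concerns every choice of them; symmetry of the weights is added as \<open>Q_swap\<close> where
  laws are compared.\<close>

locale super_ifs =
  fixes f :: "nat \<Rightarrow> nat \<Rightarrow> 'x::metric_space \<Rightarrow> 'x"
    and p :: "nat \<Rightarrow> nat \<Rightarrow> real"
    and Q :: "sifs_index \<Rightarrow> real"
    and l :: real
    and M N V :: nat
  assumes compact_X: "compact (UNIV :: 'x set)"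
    and V: "1 \<le> V"
    and l: "0 \<le> l" "l < 1"
    and f: "\<And>n m. n \<in> {1..N} \<Longrightarrow> m \<in> {1..M} \<Longrightarrow> l-lipschitz_on UNIV (f n m)"
    and p_nonneg: "\<And>n m. n \<in> {1..N} \<Longrightarrow> m \<in> {1..M} \<Longrightarrow> 0 \<le> p n m"
    and p_sum: "\<And>n. n \<in> {1..N} \<Longrightarrow> (\<Sum>m=1..M. p n m) = 1"
    and Q_nonneg: "\<And>a. a \<in> sifs_indices M N V \<Longrightarrow> 0 \<le> Q a"
    and Q_sum: "(\<Sum>a\<in>sifs_indices M N V. Q a) = 1"
begin

sublocale mk: Metric_space "borel_probs :: 'x measure set" mk_dist
  by (rule Metric_space_mk_dist[OF compact_X])

sublocale tuples: Metric_space "prob_tuples V :: (nat \<Rightarrow> 'x measure) set" "mk_dist_max V"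
  by (rule Metric_space_mk_dist_max[OF compact_X V])

lemma prob_tuplesD: "\<mu> \<in> prob_tuples V \<Longrightarrow> v \<in> {1..V} \<Longrightarrow> \<mu> v \<in> borel_probs"
  unfolding prob_tuples_def by (rule PiE_mem)

lemma sifs_indexD:
  assumes "a \<in> sifs_indices M N V" "v \<in> {1..V}"
  shows "fst (a v) \<in> {1..N}" "\<And>m. m \<in> {1..M} \<Longrightarrow> snd (a v) m \<in> {1..V}"
proof -
  have "a v \<in> {1..N} \<times> (\<Pi>\<^sub>E m\<in>{1..M}. {1..V})"
    using PiE_mem[OF assms(1)[unfolded sifs_indices_def] assms(2)] .
  then show "fst (a v) \<in> {1..N}" "\<And>m. m \<in> {1..M} \<Longrightarrow> snd (a v) m \<in> {1..V}"
    by (auto simp: mem_Times_iff PiE_iff)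
qed

lemma sifs_map_apply:
  "v \<in> {1..V} \<Longrightarrow> sifs_map M V f p a \<mu> v =
    mixture borel {1..M} (p (fst (a v))) (\<lambda>m. distr (\<mu> (snd (a v) m)) borel (f (fst (a v)) m))"
  by (simp add: sifs_map_def case_prod_beta)

lemma f_borel: "n \<in> {1..N} \<Longrightarrow> m \<in> {1..M} \<Longrightarrow> f n m \<in> borel_measurable borel"
  by (intro borel_measurable_continuous_onI lipschitz_on_continuous_on[OF f])

lemma f_measurable: "n \<in> {1..N} \<Longrightarrow> m \<in> {1..M} \<Longrightarrow> \<mu> \<in> borel_probs \<Longrightarrow> f n m \<in> borel_measurable \<mu>"
  using f_borel measurable_cong_sets unfolding borel_probs_def by blast

lemma distr_f_in: "n \<in> {1..N} \<Longrightarrow> m \<in> {1..M} \<Longrightarrow> \<mu> \<in> borel_probs \<Longrightarrow> distr \<mu> borel (f n m) \<in> borel_probs"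
  using prob_space.prob_space_distr[OF _ f_measurable] by (simp add: borel_probs_def)

lemma mixture_in:
  assumes "n \<in> {1..N}" "\<And>m. m \<in> {1..M} \<Longrightarrow> \<mu> m \<in> borel_probs"
  shows "mixture borel {1..M} (p n) \<mu> \<in> borel_probs"
  using prob_space_mixture[of "{1..M}" \<mu> borel "p n"] assms p_nonneg p_sum
  by (simp add: borel_probs_def)

lemma sifs_map_in:
  assumes "a \<in> sifs_indices M N V" "\<mu> \<in> prob_tuples V"
  shows "sifs_map M V f p a \<mu> \<in> prob_tuples V"
  unfolding prob_tuples_def
proof (rule PiE_I)
  show "sifs_map M V f p a \<mu> v \<in> borel_probs" if "v \<in> {1..V}" for v
    unfolding sifs_map_apply[OF that]
    by (intro mixture_in distr_f_in prob_tuplesD[OF assms(2)] sifs_indexD[OF assms(1) that])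
qed (auto simp: sifs_map_def)

lemma integral_sifs_map:
  fixes h :: "'x \<Rightarrow> real"
  assumes a: "a \<in> sifs_indices M N V" and \<mu>: "\<mu> \<in> prob_tuples V" and v: "v \<in> {1..V}"
    and h: "L-lipschitz_on UNIV h"
  shows "integral\<^sup>L (sifs_map M V f p a \<mu> v) h
    = (\<Sum>m=1..M. p (fst (a v)) m * (\<integral>x. h (f (fst (a v)) m x) \<partial>\<mu> (snd (a v) m)))"
proof -
  note D = sifs_indexD[OF a v]
  have \<mu>m: "\<mu> (snd (a v) m) \<in> borel_probs" if "m \<in> {1..M}" for m
    by (rule prob_tuplesD[OF \<mu> D(2)[OF that]])
  have hb: "h \<in> borel_measurable borel"
    by (intro borel_measurable_continuous_onI lipschitz_on_continuous_on[OF h])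
  have "integral\<^sup>L (sifs_map M V f p a \<mu> v) h
      = (\<Sum>m=1..M. p (fst (a v)) m * integral\<^sup>L (distr (\<mu> (snd (a v) m)) borel (f (fst (a v)) m)) h)"
    unfolding sifs_map_apply[OF v]
  proof (rule integral_mixture)
    show "integrable (distr (\<mu> (snd (a v) m)) borel (f (fst (a v)) m)) h" if "m \<in> {1..M}" for m
      by (rule integral_near_value(1)[OF compact_X h distr_f_in[OF D(1) that \<mu>m[OF that]]])
  qed (use p_nonneg D hb in auto)
  also have "\<dots> = (\<Sum>m=1..M. p (fst (a v)) m * (\<integral>x. h (f (fst (a v)) m x) \<partial>\<mu> (snd (a v) m)))"
    using f_measurable[OF D(1) _ \<mu>m] hb by (intro sum.cong refl) (simp add: integral_distr)
  finally show ?thesis .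
qed

text \<open>Integrating \<open>h\<close> after the map means averaging integrals of \<open>h\<close>
  composed with the \<open>f n m\<close>. These compositions are \<open>l\<close>-Lipschitz, and the
  weights \<open>p n\<close> sum to 1.\<close>

lemma sifs_map_contraction:
  assumes a: "a \<in> sifs_indices M N V" and \<mu>: "\<mu> \<in> prob_tuples V" and \<nu>: "\<nu> \<in> prob_tuples V"
  shows "mk_dist_max V (sifs_map M V f p a \<mu>) (sifs_map M V f p a \<nu>) \<le> l * mk_dist_max V \<mu> \<nu>"
proof (rule mk_dist_max_leI[OF compact_X V])
  fix v assume v: "v \<in> {1..V}"
  let ?n = "fst (a v)" and ?w = "snd (a v)"
  note D = sifs_indexD[OF a v]
  have in_probs: "\<mu> u \<in> borel_probs" "\<nu> u \<in> borel_probs" if "u \<in> {1..V}" for u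
    using prob_tuplesD \<mu> \<nu> that by blast+
  show "mk_dist (sifs_map M V f p a \<mu> v) (sifs_map M V f p a \<nu> v) \<le> l * mk_dist_max V \<mu> \<nu>"
  proof (rule mk_dist_leI[OF compact_X])
    show "sifs_map M V f p a \<mu> v \<in> borel_probs" "sifs_map M V f p a \<nu> v \<in> borel_probs"
      using prob_tuplesD[OF sifs_map_in[OF a] v] \<mu> \<nu> by blast+
    fix h :: "'x \<Rightarrow> real" assume h: "1-lipschitz_on UNIV h"
    have "integral\<^sup>L (sifs_map M V f p a \<mu> v) h - integral\<^sup>L (sifs_map M V f p a \<nu> v) h
        = (\<Sum>m=1..M. p ?n m * ((\<integral>x. h (f ?n m x) \<partial>\<mu> (?w m)) - (\<integral>x. h (f ?n m x) \<partial>\<nu> (?w m))))"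
      unfolding integral_sifs_map[OF a \<mu> v h] integral_sifs_map[OF a \<nu> v h]
      by (simp add: sum_subtractf right_diff_distrib)
    also have "\<dots> \<le> (\<Sum>m=1..M. p ?n m * (l * mk_dist_max V \<mu> \<nu>))"
    proof (rule sum_mono, rule mult_left_mono)
      fix m assume m: "m \<in> {1..M}"
      have "(1 * l)-lipschitz_on UNIV (\<lambda>x. h (f ?n m x))"
        by (rule lipschitz_on_compose2[OF f[OF D(1) m] lipschitz_on_subset[OF h]]) simp
      then have "l-lipschitz_on UNIV (\<lambda>x. h (f ?n m x))"
        by simp
      then have "(\<integral>x. h (f ?n m x) \<partial>\<mu> (?w m)) - (\<integral>x. h (f ?n m x) \<partial>\<nu> (?w m)) \<le> l * mk_dist (\<mu> (?w m)) (\<nu> (?w m))"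
        by (intro integral_diff_le_mk_dist[OF compact_X] in_probs D(2) m)
      also have "\<dots> \<le> l * mk_dist_max V \<mu> \<nu>"
        using l by (intro mult_left_mono mk_dist_le_max[OF compact_X] D(2) m)
      finally show "(\<integral>x. h (f ?n m x) \<partial>\<mu> (?w m)) - (\<integral>x. h (f ?n m x) \<partial>\<nu> (?w m)) \<le> l * mk_dist_max V \<mu> \<nu>" .
    qed (use p_nonneg D in auto)
    also have "\<dots> = l * mk_dist_max V \<mu> \<nu>"
      using p_sum[OF D(1)] by (simp flip: sum_distrib_right)
    finally show "integral\<^sup>L (sifs_map M V f p a \<mu> v) h - integral\<^sup>L (sifs_map M V f p a \<nu> v) h
        \<le> l * mk_dist_max V \<mu> \<nu>" .
  qed
qed

text \<open>The point of the attractor with address \<open>s\<close> is realised as the law of a random point: at step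
  \<open>k\<close> an independent random choice function \<open>n \<mapsto> m\<close>, with \<open>m\<close> distributed according to \<open>p n\<close>, selects
  the map to apply and the next buffer.\<close>

definition choice_pmf :: "nat \<Rightarrow> nat pmf" where
  "choice_pmf n = embed_pmf (\<lambda>m. if m \<in> {1..M} then p n m else 0)"

lemma pmf_choice:
  assumes "n \<in> {1..N}"
  shows "pmf (choice_pmf n) m = (if m \<in> {1..M} then p n m else 0)"
  unfolding choice_pmf_def
proof (rule pmf_embed_pmf)
  show "0 \<le> (if m \<in> {1..M} then p n m else 0)" for m
    using p_nonneg[OF assms] by simp
  have "(\<integral>\<^sup>+m. ennreal (if m \<in> {1..M} then p n m else 0) \<partial>count_space UNIV)
      = (\<Sum>m=1..M. ennreal (p n m))"
    by (subst nn_integral_count_space'[of "{1..M}"]) auto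
  also have "\<dots> = 1"
    using p_nonneg[OF assms] p_sum[OF assms] by (subst sum_ennreal) auto
  finally show "(\<integral>\<^sup>+m. ennreal (if m \<in> {1..M} then p n m else 0) \<partial>count_space UNIV) = 1" .
qed

text \<open>A choice is drawn for every \<open>n\<close> at once, so the law of the choices does not
  depend on the address and one probability space serves all addresses. Buffers share these choices;
  the resulting dependence disappears because only the law of each component is kept.\<close>

definition choices_pmf :: "(nat \<Rightarrow> nat) pmf" where
  "choices_pmf = Pi_pmf {1..N} 0 choice_pmf"

text \<open>The constant map outside the index ranges makes Lipschitz and measurability statements
  hold for all addresses and choices, without range conditions.\<close>

definition total_f :: "nat \<Rightarrow> nat \<Rightarrow> 'x \<Rightarrow> 'x" where
  "total_f n m = (if n \<in> {1..N} \<and> m \<in> {1..M} then f n m else (\<lambda>_. undefined))"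

lemma total_f_lipschitz: "l-lipschitz_on UNIV (total_f n m)"
  using f l by (auto simp: total_f_def lipschitz_on_def)

text \<open>The head of the streams gives the outermost map, in agreement with
  \<open>code_Stream\<close>. The innermost point is an arbitrary base point.\<close>

primrec approx_point :: "nat \<Rightarrow> sifs_index stream \<Rightarrow> (nat \<Rightarrow> nat) stream \<Rightarrow> nat \<Rightarrow> 'x" where
  "approx_point 0 s t v = undefined"
| "approx_point (Suc k) s t v =
    total_f (fst (shd s v)) (shd t (fst (shd s v)))
      (approx_point k (stl s) (stl t) (snd (shd s v) (shd t (fst (shd s v)))))"

text \<open>Both points arise from the same \<open>k\<close> outermost maps, applied to points at
  most a diameter apart.\<close>

lemma approx_point_near: "dist (approx_point k s t v) (approx_point (k + j) s t v) \<le> l ^ k * diameter (UNIV :: 'x set)"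
proof (induction k arbitrary: s t v)
  case 0
  then show ?case
    using dist_le_diameter[OF compact_X] by simp
next
  case (Suc k)
  let ?n = "fst (shd s v)"
  let ?m = "shd t ?n"
  let ?T = "\<lambda>k. approx_point k (stl s) (stl t) (snd (shd s v) ?m)"
  have "dist (approx_point (Suc k) s t v) (approx_point (Suc k + j) s t v) \<le> l * dist (?T k) (?T (k + j))"
    using lipschitz_onD[OF total_f_lipschitz, of "?T k" "?T (k + j)"] by simp
  also have "\<dots> \<le> l * (l ^ k * diameter (UNIV :: 'x set))"
    using Suc.IH l by (intro mult_left_mono)
  finally show ?case
    by simp
qed

definition address_point :: "sifs_index stream \<Rightarrow> (nat \<Rightarrow> nat) stream \<Rightarrow> nat \<Rightarrow> 'x" where
  "address_point s t v = lim (\<lambda>k. approx_point k s t v)"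

text \<open>The limit is taken in the compact space of points, whose completeness is immediate,
  rather than in the space of measures.\<close>

lemma approx_point_tendsto: "(\<lambda>k. approx_point k s t v) \<longlonglongrightarrow> address_point s t v"
proof -
  have "Cauchy (\<lambda>k. approx_point k s t v)"
    unfolding Cauchy_altdef2
  proof (intro allI impI)
    fix e :: real assume "0 < e"
    have "(\<lambda>k. l ^ k * diameter (UNIV :: 'x set)) \<longlonglongrightarrow> 0 * diameter (UNIV :: 'x set)"
      using l by (intro tendsto_intros LIMSEQ_power_zero) simp
    then have "\<forall>\<^sub>F k in sequentially. l ^ k * diameter (UNIV :: 'x set) < e"
      using \<open>0 < e\<close> by (intro order_tendstoD(2)) auto
    then obtain K where K: "l ^ K * diameter (UNIV :: 'x set) < e"
      by (auto simp: eventually_sequentially)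
    have "dist (approx_point k s t v) (approx_point K s t v) < e" if "K \<le> k" for k
      using approx_point_near[of K s t v "k - K"] K that by (simp add: dist_commute)
    then show "\<exists>K. \<forall>k\<ge>K. dist (approx_point k s t v) (approx_point K s t v) < e"
      by blast
  qed
  then obtain x where "(\<lambda>k. approx_point k s t v) \<longlonglongrightarrow> x"
    using compact_imp_complete[OF compact_X] unfolding complete_def by blast
  then show ?thesis
    unfolding address_point_def by (simp add: limI)
qed

lemma address_point_Stream:
  "address_point (b ## s) (c ## t) v =
    total_f (fst (b v)) (c (fst (b v))) (address_point s t (snd (b v) (c (fst (b v)))))"
proof (rule LIMSEQ_unique)
  let ?F = "total_f (fst (b v)) (c (fst (b v)))"
  show "(\<lambda>k. approx_point (Suc k) (b ## s) (c ## t) v) \<longlonglongrightarrow> address_point (b ## s) (c ## t) v"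
    by (rule LIMSEQ_Suc[OF approx_point_tendsto])
  have "isCont ?F x" for x
    using lipschitz_on_continuous_on[OF total_f_lipschitz] by (simp add: continuous_on_eq_continuous_at)
  from isCont_tendsto_compose[OF this approx_point_tendsto]
  show "(\<lambda>k. approx_point (Suc k) (b ## s) (c ## t) v) \<longlonglongrightarrow> ?F (address_point s t (snd (b v) (c (fst (b v)))))"
    by simp
qed

abbreviation "choices_law \<equiv> stream_space (measure_pmf choices_pmf)"

lemma measurable_approx_point: "(\<lambda>t. approx_point k s t v) \<in> borel_measurable choices_law"
proof (induction k arbitrary: s v)
  case (Suc k)
  have shd: "(\<lambda>t. shd t n) \<in> measurable choices_law (count_space UNIV)" for n
    by (rule measurable_compose[OF measurable_shd]) simp
  have "(\<lambda>t. total_f (fst (shd s v)) m (approx_point k (stl s) (stl t) (snd (shd s v) m)))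
      \<in> borel_measurable choices_law" for m
  proof -
    have "(\<lambda>t. approx_point k (stl s) (stl t) (snd (shd s v) m)) \<in> borel_measurable choices_law"
      by (rule measurable_compose[OF measurable_stl Suc.IH])
    moreover have "total_f (fst (shd s v)) m \<in> borel_measurable borel"
      by (intro borel_measurable_continuous_onI lipschitz_on_continuous_on[OF total_f_lipschitz])
    ultimately show ?thesis
      by (rule measurable_compose)
  qed
  then show ?case
    \<comment> \<open>The map and the next buffer depend on the current choice only through a
      natural number, so it suffices to treat each fixed value of it.\<close>
    unfolding approx_point.simps by (rule measurable_compose_countable[OF _ shd])
qed simp

lemma measurable_address_point: "(\<lambda>t. address_point s t v) \<in> borel_measurable choices_law"
  using measurable_approx_point approx_point_tendsto by (rule borel_measurable_LIMSEQ_metric)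

sublocale choices_law: prob_space choices_law
  by (rule prob_space.prob_space_stream_space[OF measure_pmf.prob_space_axioms])

definition address_law :: "sifs_index stream \<Rightarrow> nat \<Rightarrow> 'x measure" where
  "address_law s v = distr choices_law borel (\<lambda>t. address_point s t v)"

lemma address_law_in: "address_law s v \<in> borel_probs"
  using choices_law.prob_space_distr[OF measurable_address_point]
  by (simp add: borel_probs_def address_law_def)

text \<open>Condition on the first choice function: its value at \<open>n\<close> has law
  \<open>p n\<close>, and the remaining stream is independent of it with the same law. Hence each
  value \<open>m\<close> contributes, with weight \<open>p n m\<close>, the law of
  \<open>f n m\<close> applied to the point in the buffer it selects.\<close>

lemma address_law_Stream:
  assumes b: "b \<in> sifs_indices M N V" and v: "v \<in> {1..V}"
  shows "address_law (b ## s) v = mixture borel {1..M} (p (fst (b v)))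
    (\<lambda>m. distr (address_law s (snd (b v) m)) borel (f (fst (b v)) m))"
proof (rule mixture_eqI)
  fix B :: "'x set" assume B: "B \<in> sets borel"
  let ?n = "fst (b v)"
  note D = sifs_indexD[OF b v]
  define \<phi> where "\<phi> m = emeasure choices_law
    {t \<in> space choices_law. total_f ?n m (address_point s t (snd (b v) m)) \<in> B}" for m
  let ?X = "(\<lambda>t. address_point (b ## s) t v) -` B \<inter> space choices_law"
  have "emeasure (address_law (b ## s) v) B = emeasure choices_law ?X"
    unfolding address_law_def by (rule emeasure_distr[OF measurable_address_point B])
  also have "\<dots> = (\<integral>\<^sup>+c. emeasure choices_law {t \<in> space choices_law. c ## t \<in> ?X} \<partial>choices_pmf)"
    by (rule prob_space.emeasure_stream_space[OF measure_pmf.prob_space_axioms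
          measurable_sets[OF measurable_address_point B]])
  also have "\<dots> = (\<integral>\<^sup>+c. \<phi> (c ?n) \<partial>choices_pmf)"
    by (simp add: \<phi>_def address_point_Stream space_stream_space)
  also have "\<dots> = (\<integral>\<^sup>+m. \<phi> m \<partial>map_pmf (\<lambda>c. c ?n) choices_pmf)"
    by simp
  also have "map_pmf (\<lambda>c. c ?n) choices_pmf = choice_pmf ?n"
    unfolding choices_pmf_def using D(1) by (subst Pi_pmf_component) auto
  also have "(\<integral>\<^sup>+m. \<phi> m \<partial>choice_pmf ?n) = (\<Sum>m=1..M. \<phi> m * ennreal (pmf (choice_pmf ?n) m))"
    by (rule nn_integral_measure_pmf_support) (use pmf_choice[OF D(1)] in \<open>auto simp: set_pmf_iff split: if_splits\<close>)
  also have "\<dots> = (\<Sum>m=1..M. ennreal (p ?n m) * emeasure (distr (address_law s (snd (b v) m)) borel (f ?n m)) B)"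
  proof (intro sum.cong refl)
    fix m assume m: "m \<in> {1..M}"
    have F: "f ?n m \<in> borel_measurable borel"
      by (rule f_borel[OF D(1) m])
    have "distr (address_law s (snd (b v) m)) borel (f ?n m)
        = distr choices_law borel (\<lambda>t. f ?n m (address_point s t (snd (b v) m)))"
      unfolding address_law_def using distr_distr[OF F measurable_address_point] by (simp add: o_def)
    moreover have "emeasure \<dots> B = \<phi> m"
      using D(1) m B measurable_compose[OF measurable_address_point F, of s "snd (b v) m"]
      by (subst emeasure_distr) (auto simp: \<phi>_def total_f_def intro!: arg_cong2[where f = emeasure])
    ultimately show "\<phi> m * ennreal (pmf (choice_pmf ?n) m)
        = ennreal (p ?n m) * emeasure (distr (address_law s (snd (b v) m)) borel (f ?n m)) B"
      using pmf_choice[OF D(1), of m] m by (simp add: mult.commute)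
  qed
  finally show "emeasure (address_law (b ## s) v) B
      = (\<Sum>m=1..M. ennreal (p ?n m) * emeasure (distr (address_law s (snd (b v) m)) borel (f ?n m)) B)" .
qed (simp_all add: address_law_def)

definition address_tuple :: "sifs_index stream \<Rightarrow> nat \<Rightarrow> 'x measure" where
  "address_tuple s = (\<lambda>v\<in>{1..V}. address_law s v)"

lemma address_tuple_Stream:
  assumes b: "b \<in> sifs_indices M N V"
  shows "address_tuple (b ## s) = sifs_map M V f p b (address_tuple s)"
proof
  fix v
  show "address_tuple (b ## s) v = sifs_map M V f p b (address_tuple s) v"
  proof (cases "v \<in> {1..V}")
    case True
    have "mixture borel {1..M} (p (fst (b v))) (\<lambda>m. distr (address_law s (snd (b v) m)) borel (f (fst (b v)) m))
        = mixture borel {1..M} (p (fst (b v))) (\<lambda>m. distr (address_tuple s (snd (b v) m)) borel (f (fst (b v)) m))"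
      using sifs_indexD(2)[OF b True] by (intro mixture_cong) (auto simp: address_tuple_def)
    then show ?thesis
      unfolding sifs_map_apply[OF True] using address_law_Stream[OF b True] True
      by (simp add: address_tuple_def)
  qed (auto simp: address_tuple_def sifs_map_def)
qed

text \<open>The bound on distances is the one from \<open>mk_dist_le_diameter\<close>: each of two
  integrals lies within one diameter of a common value.\<close>

sublocale coded_ifs "prob_tuples V :: (nat \<Rightarrow> 'x measure) set" "mk_dist_max V" "sifs_indices M N V"
  "sifs_map M V f p" Q l "2 * diameter (UNIV :: 'x set)" address_tuple
proof
  show "finite (sifs_indices M N V)"
    unfolding sifs_indices_def by (intro finite_PiE finite_cartesian_product) auto
  show "mk_dist_max V \<mu> \<nu> \<le> 2 * diameter (UNIV :: 'x set)" if "\<mu> \<in> prob_tuples V" "\<nu> \<in> prob_tuples V" for \<mu> \<nu> :: "nat \<Rightarrow> 'x measure"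
    using that by (intro mk_dist_max_leI[OF compact_X V] mk_dist_le_diameter[OF compact_X] prob_tuplesD)
  show "address_tuple s \<in> prob_tuples V" for s
    by (auto simp: prob_tuples_def address_tuple_def address_law_in)
qed (use sifs_map_in sifs_map_contraction l Q_nonneg Q_sum address_tuple_Stream in auto)

end

subsection \<open>Symmetry in the buffers\<close>

context super_ifs
begin

abbreviation buffer_swap :: "nat \<Rightarrow> nat \<Rightarrow> nat" where
  "buffer_swap v \<equiv> Transposition.transpose 1 v"

definition swap_tuple :: "nat \<Rightarrow> (nat \<Rightarrow> 'b) \<Rightarrow> nat \<Rightarrow> 'b" where
  "swap_tuple v \<mu> = (\<lambda>u\<in>{1..V}. \<mu> (buffer_swap v u))"

text \<open>The swap must rename both the buffer that is written, \<open>u\<close>, and the buffers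
  that are read, the values of \<open>snd\<close>; then the map of the new index is the conjugate of
  the old one.\<close>

definition swap_index :: "nat \<Rightarrow> sifs_index \<Rightarrow> sifs_index" where
  "swap_index v a = (\<lambda>u\<in>{1..V}. (fst (a (buffer_swap v u)),
     \<lambda>m\<in>{1..M}. buffer_swap v (snd (a (buffer_swap v u)) m)))"

lemma buffer_swap_in: "v \<in> {1..V} \<Longrightarrow> u \<in> {1..V} \<Longrightarrow> buffer_swap v u \<in> {1..V}"
  by (auto simp: Transposition.transpose_def)

lemma buffer_swap_image: "v \<in> {1..V} \<Longrightarrow> buffer_swap v ` {1..V} = {1..V}"
  using V by (intro transpose_image_eq) auto

lemma swap_tuple_in:
  assumes "v \<in> {1..V}" "\<mu> \<in> prob_tuples V"
  shows "swap_tuple v \<mu> \<in> prob_tuples V"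
  unfolding prob_tuples_def
proof (rule PiE_I)
  show "swap_tuple v \<mu> u \<in> borel_probs" if "u \<in> {1..V}" for u
    using prob_tuplesD[OF assms(2) buffer_swap_in[OF assms(1) that]] that by (simp add: swap_tuple_def)
qed (auto simp: swap_tuple_def)

lemma swap_index_in:
  assumes v: "v \<in> {1..V}" and a: "a \<in> sifs_indices M N V"
  shows "swap_index v a \<in> sifs_indices M N V"
  unfolding sifs_indices_def
proof (rule PiE_I)
  fix u assume u: "u \<in> {1..V}"
  note D = sifs_indexD[OF a buffer_swap_in[OF v u]]
  have "(\<lambda>m\<in>{1..M}. buffer_swap v (snd (a (buffer_swap v u)) m)) \<in> (\<Pi>\<^sub>E m\<in>{1..M}. {1..V})"
    using D(2) buffer_swap_in[OF v] by (intro PiE_I) auto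
  then show "swap_index v a u \<in> {1..N} \<times> (\<Pi>\<^sub>E m\<in>{1..M}. {1..V})"
    using D(1) u unfolding swap_index_def by simp
qed (auto simp: swap_index_def)

lemma swap_index_involutory:
  assumes v: "v \<in> {1..V}" and a: "a \<in> sifs_indices M N V"
  shows "swap_index v (swap_index v a) = a"
proof
  fix u
  show "swap_index v (swap_index v a) u = a u"
  proof (cases "u \<in> {1..V}")
    case True
    have "a u \<in> {1..N} \<times> (\<Pi>\<^sub>E m\<in>{1..M}. {1..V})"
      using PiE_mem[OF a[unfolded sifs_indices_def] True] .
    then have "snd (a u) \<in> (\<Pi>\<^sub>E m\<in>{1..M}. {1..V})"
      by auto
    then have "(\<lambda>m\<in>{1..M}. snd (a u) m) = snd (a u)"
      by (rule PiE_restrict)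
    moreover have "swap_index v (swap_index v a) u = (fst (a u), \<lambda>m\<in>{1..M}. snd (a u) m)"
      using True buffer_swap_in[OF v True] by (auto simp: swap_index_def fun_eq_iff)
    ultimately show ?thesis
      by simp
  next
    case False
    then show ?thesis
      using PiE_arb[OF a[unfolded sifs_indices_def]] by (auto simp: swap_index_def)
  qed
qed

lemma bij_swap_index:
  assumes "v \<in> {1..V}"
  shows "bij_betw (swap_index v) (sifs_indices M N V) (sifs_indices M N V)"
  using swap_index_in[OF assms] swap_index_involutory[OF assms]
  by (intro bij_betw_byWitness[where f' = "swap_index v"]) auto

text \<open>The two renamings of buffers read cancel: the new index asks the swapped tuple for
  exactly the measures that the old index asked of the original tuple.\<close>

lemma sifs_map_swap:
  assumes v: "v \<in> {1..V}" and a: "a \<in> sifs_indices M N V"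
  shows "sifs_map M V f p (swap_index v a) (swap_tuple v \<mu>) = swap_tuple v (sifs_map M V f p a \<mu>)"
proof
  fix u
  show "sifs_map M V f p (swap_index v a) (swap_tuple v \<mu>) u = swap_tuple v (sifs_map M V f p a \<mu>) u"
  proof (cases "u \<in> {1..V}")
    case True
    note u' = buffer_swap_in[OF v True]
    have "swap_tuple v \<mu> (snd (swap_index v a u) m) = \<mu> (snd (a (buffer_swap v u)) m)" if "m \<in> {1..M}" for m
      using that True buffer_swap_in[OF v sifs_indexD(2)[OF a u' that]]
      by (simp add: swap_tuple_def swap_index_def)
    moreover have "fst (swap_index v a u) = fst (a (buffer_swap v u))"
      using True by (simp add: swap_index_def)
    moreover have "swap_tuple v (sifs_map M V f p a \<mu>) u = sifs_map M V f p a \<mu> (buffer_swap v u)"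
      using True by (simp add: swap_tuple_def)
    ultimately show ?thesis
      unfolding sifs_map_apply[OF True] by (simp only: sifs_map_apply[OF u']) (intro mixture_cong; simp)
  qed (auto simp: swap_tuple_def sifs_map_def)
qed

lemma mk_dist_max_swap:
  assumes "v \<in> {1..V}"
  shows "mk_dist_max V (swap_tuple v \<mu>) (swap_tuple v \<nu>) = mk_dist_max V \<mu> \<nu>"
proof -
  have "(\<lambda>u. mk_dist (swap_tuple v \<mu> u) (swap_tuple v \<nu> u)) ` {1..V}
      = (\<lambda>u. mk_dist (\<mu> u) (\<nu> u)) ` (buffer_swap v ` {1..V})"
    by (auto simp: swap_tuple_def image_image)
  then show ?thesis
    unfolding mk_dist_max_def buffer_swap_image[OF assms] by simp
qed

lemma continuous_map_swap:
  assumes "v \<in> {1..V}"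
  shows "continuous_map tuples.mtopology tuples.mtopology (swap_tuple v)"
proof (subst tuples.metric_continuous_map[OF tuples.Metric_space_axioms], intro conjI ballI allI impI)
  show "swap_tuple v ` prob_tuples V \<subseteq> prob_tuples V"
    using swap_tuple_in[OF assms] by blast
  show "\<exists>\<delta>>0. \<forall>\<nu>. \<nu> \<in> prob_tuples V \<and> mk_dist_max V \<mu> \<nu> < \<delta> \<longrightarrow>
      mk_dist_max V (swap_tuple v \<mu>) (swap_tuple v \<nu>) < \<epsilon>"
    if "0 < \<epsilon>" for \<mu> :: "nat \<Rightarrow> 'x measure" and \<epsilon>
    using that mk_dist_max_swap[OF assms, of \<mu>] by (intro exI[of _ \<epsilon>]) simp
qed

lemma continuous_map_component:
  assumes "v \<in> {1..V}"
  shows "continuous_map tuples.mtopology mk.mtopology (\<lambda>\<mu>. \<mu> v)"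
proof (subst tuples.metric_continuous_map[OF mk.Metric_space_axioms], intro conjI ballI allI impI)
  show "(\<lambda>\<mu>. \<mu> v) ` prob_tuples V \<subseteq> borel_probs"
    using prob_tuplesD assms by blast
  show "\<exists>\<delta>>0. \<forall>\<nu>. \<nu> \<in> prob_tuples V \<and> mk_dist_max V \<mu> \<nu> < \<delta> \<longrightarrow> mk_dist (\<mu> v) (\<nu> v) < \<epsilon>"
    if "0 < \<epsilon>" for \<mu> :: "nat \<Rightarrow> 'x measure" and \<epsilon>
    using that mk_dist_le_max[OF compact_X assms, of \<mu>] by (intro exI[of _ \<epsilon>]) (auto intro: order_le_less_trans)
qed

text \<open>By \<open>sifs_map_swap\<close> the swap can be moved past every map at the price of
  permuting the indices, so the image solves the same fixed-set equation.\<close>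

lemma swap_attractor:
  assumes v: "v \<in> {1..V}"
  shows "swap_tuple v ` attractor = attractor"
proof (rule attractor_unique)
  show "swap_tuple v ` attractor \<noteq> {}"
    using some_code by (auto simp: attractor_def)
  show "compactin tuples.mtopology (swap_tuple v ` attractor)"
    by (rule image_compactin[OF compactin_attractor continuous_map_swap[OF v]])
  have "swap_tuple v ` attractor = (\<Union>a\<in>sifs_indices M N V. swap_tuple v ` sifs_map M V f p a ` attractor)"
    by (subst attractor_invariant) (simp add: image_UN)
  also have "\<dots> = (\<Union>a\<in>sifs_indices M N V. sifs_map M V f p (swap_index v a) ` swap_tuple v ` attractor)"
    by (intro SUP_cong refl) (simp add: image_image sifs_map_swap[OF v])
  also have "\<dots> = (\<Union>a\<in>swap_index v ` sifs_indices M N V. sifs_map M V f p a ` swap_tuple v ` attractor)"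
    by (simp add: image_image)
  also have "swap_index v ` sifs_indices M N V = sifs_indices M N V"
    using bij_swap_index[OF v] by (rule bij_betw_imp_surj_on)
  finally show "swap_tuple v ` attractor = (\<Union>a\<in>sifs_indices M N V. sifs_map M V f p a ` swap_tuple v ` attractor)" .
qed

lemma component_set_attractor:
  assumes v: "v \<in> {1..V}"
  shows "component_set v attractor = component_set 1 attractor"
proof -
  have "component_set v attractor = (\<lambda>\<mu>. swap_tuple v \<mu> v) ` attractor"
    unfolding component_set_def by (subst swap_attractor[OF v, symmetric]) (simp add: image_image)
  also have "\<dots> = component_set 1 attractor"
    using v by (simp add: component_set_def swap_tuple_def)
  finally show ?thesis .
qed

lemma distr_swap_attractor_law:
  assumes v: "v \<in> {1..V}"
    and Q_swap: "\<And>a. a \<in> sifs_indices M N V \<Longrightarrow> Q (swap_index v a) = Q a"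
  shows "distr attractor_law (borel_of tuples.mtopology) (swap_tuple v) = attractor_law"
proof (rule invariant_measure_unique[OF _ _ _ attractor_law.prob_space_axioms sets_attractor_law attractor_law_invariant])
  let ?S = "borel_of tuples.mtopology" and ?R = attractor_law and ?A = "sifs_indices M N V"
  let ?R' = "distr ?R ?S (swap_tuple v)"
  have swap: "swap_tuple v \<in> measurable ?S ?S"
    by (rule continuous_map_measurable_borel_of[OF continuous_map_swap[OF v]])
  then have swap': "swap_tuple v \<in> measurable ?R ?S"
    using measurable_cong_sets[OF sets_attractor_law] by blast
  have g': "sifs_map M V f p a \<in> measurable ?R ?S" if "a \<in> ?A" for a
    using measurable_g[OF that] measurable_cong_sets[OF sets_attractor_law] by blast
  show "prob_space ?R'"
    by (rule attractor_law.prob_space_distr[OF swap'])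
  show "sets ?R' = sets ?S"
    by simp
  show "?R' = mixture ?S ?A Q (\<lambda>a. distr ?R' ?S (sifs_map M V f p a))"
  proof (rule mixture_eqI[OF finite_I])
    fix B assume B: "B \<in> sets ?S"
    have SB: "swap_tuple v -` B \<inter> space ?S \<in> sets ?S"
      by (rule measurable_sets[OF swap B])
    have "emeasure ?R' B = emeasure ?R (swap_tuple v -` B \<inter> space ?S)"
      using emeasure_distr[OF swap' B] by simp
    also have "\<dots> = emeasure (mixture ?S ?A Q (\<lambda>a. distr ?R ?S (sifs_map M V f p a))) (swap_tuple v -` B \<inter> space ?S)"
      using attractor_law_invariant by simp
    also have "\<dots> = (\<Sum>a\<in>?A. ennreal (Q a) * emeasure (distr ?R ?S (sifs_map M V f p a)) (swap_tuple v -` B \<inter> space ?S))"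
      by (rule emeasure_mixture[OF finite_I _ SB]) simp
    \<comment> \<open>Each summand is rewritten with the renamed index; \<open>Q_swap\<close> does
      this for the weight and \<open>sifs_map_swap\<close> for the map. The sum is then reindexed
      along the bijection \<open>swap_index v\<close>.\<close>
    also have "\<dots> = (\<Sum>a\<in>?A. ennreal (Q (swap_index v a)) * emeasure (distr ?R' ?S (sifs_map M V f p (swap_index v a))) B)"
    proof (intro sum.cong refl)
      fix a assume a: "a \<in> ?A"
      have "emeasure (distr ?R ?S (sifs_map M V f p a)) (swap_tuple v -` B \<inter> space ?S)
          = emeasure (distr (distr ?R ?S (sifs_map M V f p a)) ?S (swap_tuple v)) B"
        using swap B by (subst (2) emeasure_distr) simp_all
      also have "distr (distr ?R ?S (sifs_map M V f p a)) ?S (swap_tuple v) = distr ?R ?S (swap_tuple v \<circ> sifs_map M V f p a)"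
        by (rule distr_distr[OF swap g'[OF a]])
      also have "swap_tuple v \<circ> sifs_map M V f p a = sifs_map M V f p (swap_index v a) \<circ> swap_tuple v"
        using sifs_map_swap[OF v a] by (simp add: fun_eq_iff)
      also have "distr ?R ?S (sifs_map M V f p (swap_index v a) \<circ> swap_tuple v) = distr ?R' ?S (sifs_map M V f p (swap_index v a))"
        by (rule distr_distr[OF measurable_g[OF swap_index_in[OF v a]] swap', symmetric])
      finally show "ennreal (Q a) * emeasure (distr ?R ?S (sifs_map M V f p a)) (swap_tuple v -` B \<inter> space ?S)
          = ennreal (Q (swap_index v a)) * emeasure (distr ?R' ?S (sifs_map M V f p (swap_index v a))) B"
        using Q_swap[OF a] by simp
    qed
    also have "\<dots> = (\<Sum>a\<in>?A. ennreal (Q a) * emeasure (distr ?R' ?S (sifs_map M V f p a)) B)"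
      by (rule sum.reindex_bij_betw[OF bij_swap_index[OF v]])
    finally show "emeasure ?R' B = (\<Sum>a\<in>?A. ennreal (Q a) * emeasure (distr ?R' ?S (sifs_map M V f p a)) B)" .
  qed simp_all
qed

text \<open>Invariance under exchanging buffers 1 and \<open>v\<close> identifies all one-component
  marginals with the first; this is why the limit does not depend on \<open>v\<close>.\<close>

lemma integral_first_marginal:
  assumes v: "v \<in> {1..V}"
    and Q_swap: "\<And>a. a \<in> sifs_indices M N V \<Longrightarrow> Q (swap_index v a) = Q a"
    and h: "continuous_map mk.mtopology euclideanreal h"
  shows "integral\<^sup>L (first_marginal attractor_law) h = (\<integral>\<mu>. h (\<mu> v) \<partial>attractor_law)"
proof -
  let ?S = "borel_of tuples.mtopology"
  have hv: "(\<lambda>\<mu>. h (\<mu> u)) \<in> borel_measurable ?S" if "u \<in> {1..V}" for u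
    using continuous_map_compose[OF continuous_map_component[OF that] h]
    by (intro continuous_map_borel_measurable) (simp add: o_def)
  have "(\<integral>\<mu>. h (\<mu> v) \<partial>attractor_law) = (\<integral>\<mu>. h (\<mu> v) \<partial>distr attractor_law ?S (swap_tuple v))"
    using distr_swap_attractor_law[OF v Q_swap] by simp
  also have "\<dots> = (\<integral>\<mu>. h (swap_tuple v \<mu> v) \<partial>attractor_law)"
    using continuous_map_measurable_borel_of[OF continuous_map_swap[OF v]]
      measurable_cong_sets[OF sets_attractor_law refl]
    by (intro integral_distr hv[OF v]) blast
  also have "\<dots> = (\<integral>\<mu>. h (\<mu> 1) \<partial>attractor_law)"
    using v by (simp add: swap_tuple_def)
  also have "\<dots> = integral\<^sup>L (first_marginal attractor_law) h"
    unfolding first_marginal_def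
    using continuous_map_measurable_borel_of[OF continuous_map_component[of 1]] V
      measurable_cong_sets[OF sets_attractor_law refl]
    by (intro integral_distr[symmetric] continuous_map_borel_measurable[OF h]) auto
  finally show ?thesis ..
qed

section \<open>Convergence of the empirical measures\<close>

lemma integral_empirical_measure:
  assumes "\<And>k. y k \<in> borel_probs" and h: "continuous_map mk.mtopology euclideanreal h"
  shows "integral\<^sup>L (empirical_measure mk.mtopology y n) h = (\<Sum>k<n. h (y (Suc k))) / real n"
proof -
  have hb: "h \<in> borel_measurable (borel_of mk.mtopology)"
    by (rule continuous_map_borel_measurable[OF h])
  have "integral\<^sup>L (empirical_measure mk.mtopology y n) h
      = (\<Sum>k=1..n. 1 / real n * integral\<^sup>L (return (borel_of mk.mtopology) (y k)) h)"
    unfolding empirical_measure_def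
  proof (rule integral_mixture)
    show "integrable (return (borel_of mk.mtopology) (y k)) h" if "k \<in> {1..n}" for k
      using hb assms(1) by (intro integrableI_bounded) (simp_all add: nn_integral_return)
  qed (use hb in auto)
  also have "\<dots> = (\<Sum>k=1..n. h (y k)) / real n"
    using hb assms(1) by (simp add: integral_return sum_divide_distrib)
  also have "(\<Sum>k=1..n. h (y k)) = (\<Sum>k<n. h (y (Suc k)))"
    by (simp add: sum.atLeast1_atMost_eq)
  finally show ?thesis .
qed

lemma empirical_measures_converge:
  assumes \<Omega>: "prob_space \<Omega>"
    and indep: "prob_space.indep_vars \<Omega> (\<lambda>_. count_space (sifs_indices M N V)) a {1..}"
    and law: "\<And>k b. 1 \<le> k \<Longrightarrow> b \<in> sifs_indices M N V \<Longrightarrow> measure \<Omega> {\<omega> \<in> space \<Omega>. a k \<omega> = b} = Q b"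
    and init: "\<mu>_init \<in> prob_tuples V"
    and \<mu>1: "\<And>\<omega>. \<omega> \<in> space \<Omega> \<Longrightarrow> \<mu> 1 \<omega> = \<mu>_init"
    and \<mu>_Suc: "\<And>k \<omega>. 1 \<le> k \<Longrightarrow> \<omega> \<in> space \<Omega> \<Longrightarrow> \<mu> (Suc k) \<omega> = sifs_map M V f p (a k \<omega>) (\<mu> k \<omega>)"
    and Q_swap: "\<And>v a. v \<in> {1..V} \<Longrightarrow> a \<in> sifs_indices M N V \<Longrightarrow> Q (swap_index v a) = Q a"
  shows "AE \<omega> in \<Omega>. \<forall>v\<in>{1..V}. weakly_converges mk.mtopology
    (empirical_measure mk.mtopology (\<lambda>k. \<mu> k \<omega> v)) (first_marginal attractor_law)"
proof -
  interpret \<Omega>: prob_space \<Omega> by fact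
  let ?A = "sifs_indices M N V"
  have indep': "\<Omega>.indep_vars (\<lambda>_. count_space ?A) (\<lambda>k. a (Suc k)) UNIV"
    unfolding \<Omega>.indep_vars_def2 \<Omega>.indep_sets_def
  proof (intro conjI ballI allI impI)
    let ?F = "\<lambda>k. {a k -` B \<inter> space \<Omega> |B. B \<in> sets (count_space ?A)}"
    show "\<Omega>.random_variable (count_space ?A) (a (Suc k))" for k
      using indep by (simp add: \<Omega>.indep_vars_def2)
    show "?F (Suc k) \<subseteq> \<Omega>.events" for k
      using indep unfolding \<Omega>.indep_vars_def2 \<Omega>.indep_sets_def by simp
    fix J :: "nat set" and B assume J: "J \<noteq> {}" "finite J" "B \<in> (\<Pi> k\<in>J. ?F (Suc k))"
    have "\<Omega>.prob (\<Inter>k\<in>Suc ` J. B (k - 1)) = (\<Prod>k\<in>Suc ` J. \<Omega>.prob (B (k - 1)))"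
      using J by (intro \<Omega>.indep_setsD[OF conjunct2[OF indep[unfolded \<Omega>.indep_vars_def2]]]) auto
    then show "\<Omega>.prob (\<Inter>k\<in>J. B k) = (\<Prod>k\<in>J. \<Omega>.prob (B k))"
      by (simp add: image_image prod.reindex)
  qed
  \<comment> \<open>Measurability into the \<open>count_space\<close> of the index set includes that
    the values lie in this set.\<close>
  have a_in: "a (Suc k) \<omega> \<in> ?A" if "\<omega> \<in> space \<Omega>" for k \<omega>
  proof -
    have "a (Suc k) \<in> measurable \<Omega> (count_space ?A)"
      using indep' by (auto simp: \<Omega>.indep_vars_def)
    from measurable_space[OF this that] show ?thesis
      by simp
  qed
  \<comment> \<open>This single null set serves all buffers \<open>v\<close> and all test functions,
    which are fixed only afterwards.\<close>
  have "AE \<omega> in \<Omega>. \<forall>w\<in>lists ?A.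
      (\<lambda>n. (\<Sum>k<n. of_bool (match (\<lambda>j. a (Suc j) \<omega>) k w)) / real n) \<longlonglongrightarrow> prod_list (map Q w)"
  proof (subst AE_ball_countable)
    show "countable (lists ?A)"
      by (intro countable_lists countable_finite finite_I)
    show "\<forall>w\<in>lists ?A. AE \<omega> in \<Omega>.
      (\<lambda>n. (\<Sum>k<n. of_bool (match (\<lambda>j. a (Suc j) \<omega>) k w)) / real n) \<longlonglongrightarrow> prod_list (map Q w)"
      using law by (intro ballI \<Omega>.match_frequency[OF indep']) (auto simp: lists_eq_set)
  qed
  then show ?thesis
    using AE_space
  proof eventually_elim
    case (elim \<omega>)
    show ?case
      unfolding weakly_converges_def
    proof (intro ballI allI impI)
      fix v and h :: "'x measure \<Rightarrow> real"
      assume v: "v \<in> {1..V}" and "continuous_map mk.mtopology euclideanreal h \<and> bounded (h ` topspace mk.mtopology)"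
      then have h: "continuous_map mk.mtopology euclideanreal h" and "bounded (h ` borel_probs)"
        by simp_all
      then obtain B where B: "\<And>\<nu>. \<nu> \<in> borel_probs \<Longrightarrow> \<bar>h \<nu>\<bar> \<le> B"
        by (auto simp: bounded_iff)
      have \<mu>_in: "\<mu> (Suc k) \<omega> \<in> prob_tuples V" for k
        by (induction k) (use elim init \<mu>1 \<mu>_Suc sifs_map_in a_in in auto)
      have "(\<lambda>n. (\<Sum>k<n. h (\<mu> (Suc k) \<omega> v)) / real n) \<longlonglongrightarrow> (\<integral>\<nu>. h (\<nu> v) \<partial>attractor_law)"
      proof (rule orbit_averages[where x = "\<lambda>k. a (Suc k) \<omega>" and y = "\<lambda>k. \<mu> (Suc k) \<omega>" and h = "\<lambda>\<nu>. h (\<nu> v)"])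
        show "continuous_map tuples.mtopology euclideanreal (\<lambda>\<nu>. h (\<nu> v))"
          using continuous_map_compose[OF continuous_map_component[OF v] h] by (simp add: o_def)
        show "\<bar>h (\<nu> v)\<bar> \<le> B" if "\<nu> \<in> prob_tuples V" for \<nu>
          by (rule B[OF prob_tuplesD[OF that v]])
      qed (use elim a_in \<mu>_in \<mu>_Suc in \<open>auto simp: lists_eq_set\<close>)
      then have "(\<lambda>n. (\<Sum>k<n. h (\<mu> (Suc k) \<omega> v)) / real n) \<longlonglongrightarrow> integral\<^sup>L (first_marginal attractor_law) h"
        using integral_first_marginal[OF v Q_swap[OF v] h] by simp
      moreover have "integral\<^sup>L (empirical_measure mk.mtopology (\<lambda>k. \<mu> k \<omega> v) n) h
          = (\<Sum>k<n. h (\<mu> (Suc k) \<omega> v)) / real n" for n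
      proof -
        \<comment> \<open>Nothing is known about \<open>\<mu> 0\<close>. The empirical measure
          starts at time 1, so the value at 0 may be replaced to obtain a sequence lying entirely in
          \<open>borel_probs\<close>.\<close>
        let ?y = "\<lambda>k. \<mu> (if k = 0 then 1 else k) \<omega> v"
        have "empirical_measure mk.mtopology (\<lambda>k. \<mu> k \<omega> v) n = empirical_measure mk.mtopology ?y n"
          unfolding empirical_measure_def by (intro mixture_cong) auto
        moreover have "?y k \<in> borel_probs" for k
          using prob_tuplesD[OF \<mu>_in v] by (cases k) auto
        ultimately show ?thesis
          using integral_empirical_measure[of ?y h n] h by simp
      qed
      ultimately show "(\<lambda>n. integral\<^sup>L (empirical_measure mk.mtopology (\<lambda>k. \<mu> k \<omega> v) n) h)
          \<longlonglongrightarrow> integral\<^sup>L (first_marginal attractor_law) h"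
        by simp
    qed
  qed
qed

text \<open>The renaming permutes the factors \<open>P (fst (a u))\<close> among the buffers, leaves
  their product unchanged, and the denominator is constant.\<close>

lemma product_weights_swap:
  assumes v: "v \<in> {1..V}" and a: "a \<in> sifs_indices M N V"
    and Q: "\<And>a. a \<in> sifs_indices M N V \<Longrightarrow> Q a = (\<Prod>v=1..V. P (fst (a v))) / c"
  shows "Q (swap_index v a) = Q a"
proof -
  have "(\<Prod>u=1..V. P (fst (swap_index v a u))) = (\<Prod>u\<in>{1..V}. P (fst (a (buffer_swap v u))))"
    by (intro prod.cong) (auto simp: swap_index_def)
  also have "\<dots> = (\<Prod>u\<in>{1..V}. P (fst (a u)))"
  proof (rule prod.reindex_bij_betw)
    show "bij_betw (buffer_swap v) {1..V} {1..V}"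
      using buffer_swap_image[OF v] by (simp add: bij_betw_def inj_on_subset[OF inj_transpose])
  qed
  finally show ?thesis
    using Q[OF a] Q[OF swap_index_in[OF v a]] by simp
qed

end

theorem theorem21:
  fixes f :: "nat \<Rightarrow> nat \<Rightarrow> 'x::metric_space \<Rightarrow> 'x"
    and p :: "nat \<Rightarrow> nat \<Rightarrow> real"
    and P :: "nat \<Rightarrow> real"
    and Q :: "sifs_index \<Rightarrow> real"
    and l :: real
    and M N V :: nat
  assumes "compact (UNIV :: 'x set)"
    and "1 \<le> M" "1 \<le> N" "1 \<le> V"
    and "0 \<le> l" "l < 1"
    and "\<forall>n\<in>{1..N}. \<forall>m\<in>{1..M}. l-lipschitz_on UNIV (f n m)"
    and "\<forall>n\<in>{1..N}. \<forall>m\<in>{1..M}. 0 \<le> p n m"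
    and "\<forall>n\<in>{1..N}. (\<Sum>m=1..M. p n m) = 1"
    and "\<forall>n\<in>{1..N}. 0 < P n"
    and "(\<Sum>n=1..N. P n) = 1"
    and "\<forall>a\<in>sifs_indices M N V. 0 \<le> Q a"
    and "(\<Sum>a\<in>sifs_indices M N V. Q a) = 1"
  shows "(\<forall>v\<in>{1..V}. component_set v (sifs_set_attractor M N V f p)
                     = component_set 1 (sifs_set_attractor M N V f p)) \<and>
    ((\<forall>a\<in>sifs_indices M N V. Q a = (\<Prod>v=1..V. P (fst (a v))) / real V ^ (M * V)) \<longrightarrow>
      (\<forall>(\<Omega> :: 'w measure) (a :: nat \<Rightarrow> 'w \<Rightarrow> sifs_index)
        (\<mu>0 :: nat \<Rightarrow> 'x measure) (\<mu> :: nat \<Rightarrow> 'w \<Rightarrow> nat \<Rightarrow> 'x measure).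
        prob_space \<Omega> \<and>
        prob_space.indep_vars \<Omega> (\<lambda>_. count_space (sifs_indices M N V)) a {1..} \<and>
        (\<forall>k\<ge>1. \<forall>b\<in>sifs_indices M N V. measure \<Omega> {\<omega>\<in>space \<Omega>. a k \<omega> = b} = Q b) \<and>
        \<mu>0 \<in> prob_tuples V \<and>
        (\<forall>\<omega>\<in>space \<Omega>. \<mu> 1 \<omega> = \<mu>0) \<and>
        (\<forall>k\<ge>1. \<forall>\<omega>\<in>space \<Omega>. \<mu> (Suc k) \<omega> = sifs_map M V f p (a k \<omega>) (\<mu> k \<omega>))
        \<longrightarrow> (AE \<omega> in \<Omega>. \<forall>v\<in>{1..V}.
              weakly_converges mk_topology (empirical_measure mk_topology (\<lambda>k. \<mu> k \<omega> v))
                (first_marginal (sifs_measure_attractor M N V f p Q)))))"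
proof -
  interpret super_ifs f p Q l M N V
    by unfold_locales (use assms in auto)
  have set_eq: "sifs_set_attractor M N V f p = attractor"
    unfolding sifs_set_attractor_def by (rule set_attractor_eq)
  have measure_eq: "sifs_measure_attractor M N V f p Q = attractor_law"
    unfolding sifs_measure_attractor_def by (rule measure_attractor_eq)
  show ?thesis
    unfolding set_eq measure_eq
  proof (intro conjI ballI impI allI, goal_cases)
    case (1 v)
    then show ?case
      by (rule component_set_attractor)
  next
    case (2 \<Omega> a \<mu>0 \<mu>)
    then have Q: "\<And>a. a \<in> sifs_indices M N V \<Longrightarrow> Q a = (\<Prod>v=1..V. P (fst (a v))) / real V ^ (M * V)"
      by blast
    show ?case
      by (rule empirical_measures_converge[where a = a and \<mu>_init = \<mu>0])
        (use 2 product_weights_swap[OF _ _ Q] in blast)+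
  qed
qed

end
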